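(* The Return Times for the Tail Property does not hold in $L^1$. That is, there exist a measure preserving system $(X,\mathcal{B},\mu,T)$ and a function $f\in L^1(\mu)$ for which there is no set $X_f\in\mathcal{B}$ with $\mu(X_f)=1$ having the following property: for every $x\in X_f$, every measure preserving system $(Y,\mathcal{G},\nu,S)$ and every $g\in L^1(\nu)$, the sequence $\frac{f(T^nx)\cdot g(S^ny)}{n}$ converges to $0$ as $n\to\infty$ for $\nu$-a.e. $y\in Y$.
   Context: A measure preserving system $(X,\mathcal{B},\mu,T)$ consists of a probability space $(X,\mathcal{B},\mu)$ and an invertible measure preserving transformation $T$ of it. For $1\le r\le\infty$, the Return Times for the Tail Property is said to hold in $L^r(\mu)$ (for the system $(X,\mathcal{B},\mu,T)$) if for each $f\in L^r(\mu)$ there is a set $X_f$ of full measure such that for all $x\in X_f$, all measure preserving systems $(Y,\mathcal{G},\nu,S)$ and each $g\in L^1(\nu)$, the sequence $\frac{f(T^nx)\cdot g(S^ny)}{n}$ converges to zero for $\nu$-a.e. $y$. *)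

theory Defs
  imports "HOL-Probability.Probability"
begin

definition measure_preserving_system :: "'a measure \<Rightarrow> ('a \<Rightarrow> 'a) \<Rightarrow> bool" where
  "measure_preserving_system M T \<longleftrightarrow>
     prob_space M \<and>
     bij_betw T (space M) (space M) \<and>
     T \<in> measurable M M \<and>
     the_inv_into (space M) T \<in> measurable M M \<and>
     distr M M T = M"

text \<open>
  HOL cannot quantify over the type of points of a system inside a formula, so statements about
  all systems have to fix that type. A space of type \<^typ>\<open>real measure\<close> is an arbitrary set of
  reals with an arbitrary sigma-algebra and an arbitrary measure; in particular every standard
  Borel system occurs up to isomorphism. For statements that involve a system only through the
  joint distribution of one integrable real function along orbits this loses nothing: one may pass
  to the factor generated by that function, which is a shift-invariant Borel probability measure
  on the space of real sequences indexed by the integers.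
\<close>

end

theory Submission
  imports Defs
begin

text \<open>
  For a nonnegative sequence \<open>u\<close> let \<open>N\<^sub>n(u)\<close> be the number of \<open>k \<ge> 1\<close> with \<open>u k / k \<ge> 1 / n\<close>.
  The theorem follows from a counting statement: there are a system \<open>(M, T)\<close> and an integrable
  \<open>f \<ge> 0\<close> such that for almost every \<open>x\<close> the orbit sequence \<open>u k = f (T\<^sup>k x)\<close> satisfies
  \<open>sup\<^sub>n N\<^sub>n(u) / n = \<infinity>\<close>.

  \<^emph>\<open>From counting to the tail.\<close> Fix such a \<open>u\<close>. There are \<open>h\<^sub>j\<close> and finite sets \<open>D\<^sub>j\<close> of at least
  \<open>2 j 2\<^sup>j h\<^sub>j\<close> times \<open>k > j\<close> with \<open>k \<le> h\<^sub>j u k\<close>. Let the coordinates \<open>y\<^sub>i\<close> be independent, each at least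
  \<open>h\<^sub>j\<close> with probability at least \<open>2\<^sup>-\<^sup>j\<^sup>-\<^sup>1 / h\<^sub>j\<close>; this is compatible with a finite mean. The
  probability that no \<open>k\<close> in \<open>D\<^sub>j\<close> has \<open>y\<^sub>k \<ge> h\<^sub>j\<close> is at most \<open>exp (-j)\<close>, so by Borel and Cantelli
  almost every \<open>y\<close> has infinitely many \<open>k\<close> with \<open>u k * y\<^sub>k \<ge> k\<close>. The shift on these sequences, with \<open>g\<close>
  the coordinate at \<open>0\<close>, is the required second system (\<open>ex_system_detecting_visits\<close>).

  \<^emph>\<open>Why the counting function blows up.\<close> The part of \<open>f\<close> where \<open>f = V\<close> is a \<open>V\<close>-multiple of the
  indicator of a set \<open>A\<close>, and it contributes to \<open>N\<^sub>n(u) / n\<close> the visits to \<open>A\<close> up to time \<open>n V\<close>,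
  divided by \<open>n\<close>. If the values \<open>V\<close> lie on widely separated scales, the different parts
  are averaged at the same \<open>n\<close> but over widely different lengths of orbit. Each part obeys the maximal
  inequality, but their sum does not, because one \<open>n\<close>, depending on \<open>x\<close>, can be good for all parts at
  once. For a single part take the set of integers whose bits at \<open>S\<close> widely spaced places are all
  one. It has density \<open>2\<^sup>-\<^sup>S\<close>. If the bits of \<open>t\<close> at all but the lowest \<open>i\<close> of these places are one,
  which happens with probability \<open>2\<^sup>i\<^sup>-\<^sup>S\<close>, then at some scale the set has density about
  \<open>2\<^sup>-\<^sup>i\<close> just after \<open>t\<close>. So the best density has mean of order \<open>S 2\<^sup>-\<^sup>S\<close>, which exceeds the true
  density by a factor of order \<open>S\<close> (\<open>multiscale_bit_pattern\<close>).

  These patterns are stacked. Given a function on a cycle and for each point \<open>x\<close> a long range of good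
  \<open>n\<close>, replace each point by a tower of height \<open>V\<close>, put \<open>V\<close> times the old function on the bases, and
  on the tower over \<open>x\<close> a bit pattern whose scales all lie inside the range belonging to \<open>x\<close>. The
  old score is kept, the gain from the new pattern is added, and a shorter good range remains
  (\<open>scored_cycle_step\<close>). The gains behave like independent variables, so \<open>exp (-score)\<close> has a
  mean that is multiplied by a fixed factor at every step. After \<open>2\<^sup>S\<close> steps the function has mean at
  most \<open>1\<close>, while the score is of order \<open>S\<close> outside a small set (\<open>cyclic_counting_blowup\<close>). Finally a
  sequence of such cycles is combined in one infinite product, with \<open>f\<close> the sum of the functions of
  the single coordinates (\<open>ex_counting_failure\<close>).
\<close>

section \<open>Residues and binary digits\<close>

lemma sum_mod_window:
  fixes h :: "nat \<Rightarrow> nat"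
  assumes "p > 0"
  shows "(\<Sum>k\<in>{a..<a+p}. h (k mod p)) = (\<Sum>k<p. h k)"
proof (induction a)
  case 0
  then show ?case by (simp add: atLeast0LessThan)
next
  case (Suc a)
  have "(\<Sum>k\<in>{a..<a+p}. h (k mod p)) = h (a mod p) + (\<Sum>k\<in>{Suc a..<a+p}. h (k mod p))"
    using assms by (simp add: sum.atLeast_Suc_lessThan)
  moreover have "(\<Sum>k\<in>{Suc a..<Suc a+p}. h (k mod p)) = (\<Sum>k\<in>{Suc a..<a+p}. h (k mod p)) + h ((a+p) mod p)"
    using assms by (simp add: sum.atLeastLessThan_Suc)
  ultimately show ?case using Suc by simp
qed

text \<open>
  A periodic set meets a window of arbitrary starting point at least as often as the whole periods
  contained in the window require.
\<close>

lemma card_mod_window: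
  assumes "p > 0"
  shows "(n div p) * card {k. k < p \<and> Q k} \<le> card {k \<in> {1..n}. Q ((t + k) mod p)}"
proof -
  define q where "q = n div p"
  have qp: "q * p \<le> n" by (simp add: q_def)
  define h :: "nat \<Rightarrow> nat" where "h = (\<lambda>k. if Q k then 1 else 0)"
  have whole: "(\<Sum>k\<in>{a..<a+q*p}. h (k mod p)) = q * (\<Sum>k<p. h k)" for a q
  proof (induction q)
    case (Suc q)
    have "(\<Sum>k\<in>{a..<a+Suc q*p}. h (k mod p)) =
        (\<Sum>k\<in>{a..<a+q*p}. h (k mod p)) + (\<Sum>k\<in>{a+q*p..<(a+q*p)+p}. h (k mod p))"
      by (subst sum.atLeastLessThan_concat) (auto simp: algebra_simps)
    then show ?case unfolding sum_mod_window[OF assms] Suc by simp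
  qed simp
  have cardh: "(\<Sum>k<p. h k) = card {k. k < p \<and> Q k}"
    unfolding h_def by (simp add: sum.If_cases) (rule arg_cong[where f=card], auto)
  have "q * card {k. k < p \<and> Q k} = (\<Sum>k\<in>{t+1..<t+1+q*p}. h (k mod p))"
    using whole[of "t+1" q] cardh by simp
  also have "\<dots> \<le> (\<Sum>k\<in>{t+1..<t+1+n}. h (k mod p))"
    using qp by (intro sum_mono2) auto
  also have "\<dots> = (\<Sum>k\<in>{1..n}. h ((t+k) mod p))"
    by (rule sum.reindex_bij_witness[of _ "\<lambda>k. t+k" "\<lambda>k. k-t"]) auto
  also have "\<dots> = card {k \<in> {1..n}. Q ((t + k) mod p)}"
    unfolding h_def by (simp add: sum.If_cases) (rule arg_cong[where f=card], auto)
  finally show ?thesis unfolding q_def .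
qed

lemma less_two_power_iff_bits:
  fixes t :: nat
  shows "t < 2 ^ v \<longleftrightarrow> (\<forall>i\<ge>v. \<not> bit t i)"
proof -
  have "t < 2 ^ v \<longleftrightarrow> take_bit v t = t"
    by (simp add: take_bit_nat_eq_self_iff)
  also have "\<dots> \<longleftrightarrow> (\<forall>i\<ge>v. \<not> bit t i)"
    unfolding bit_eq_iff[of "take_bit v t" t] bit_take_bit_iff
    by (auto simp: not_less[symmetric])
  finally show ?thesis .
qed

text \<open>
  Distinct binary digits of a uniformly distributed number below \<open>2 ^ v\<close> are independent and fair.
  The induction uses that flipping one digit preserves every condition on the others.
\<close>

lemma card_prescribed_bits:
  fixes \<beta> :: "nat \<Rightarrow> bool"
  assumes "finite I" "I \<subseteq> {..<v}"
  shows "card {t::nat. t < 2 ^ v \<and> (\<forall>i\<in>I. bit t i = \<beta> i)} = 2 ^ (v - card I)"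
  using assms
proof (induction I rule: finite_induct)
  case empty
  have "{t::nat. t < 2 ^ v} = {..<2^v}" by auto
  then show ?case by simp
next
  case (insert j I)
  define X where "X c = {t::nat. t < 2 ^ v \<and> (\<forall>i\<in>I. bit t i = \<beta> i) \<and> bit t j = c}" for c
  have fin: "finite (X c)" for c
    by (rule finite_subset[of _ "{..<2^v}"]) (auto simp: X_def)
  have flip: "flip_bit j t \<in> X (\<not> c)" if "t \<in> X c" for t c
    using that insert.prems insert.hyps
    by (auto simp: X_def less_two_power_iff_bits bit_flip_bit_iff)
  have flip2: "flip_bit j (flip_bit j t) = t" for t :: nat
    by (rule bit_eqI) (auto simp: bit_flip_bit_iff)
  have le: "card (X c) \<le> card (X (\<not> c))" for c
    by (rule card_inj_on_le[of "flip_bit j"]) (use flip flip2 fin in \<open>auto intro: inj_on_inverseI\<close>)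
  have eq: "card (X (\<not> \<beta> j)) = card (X (\<beta> j))"
    using le[of "\<beta> j"] le[of "\<not> \<beta> j"] by simp
  have "{t::nat. t < 2 ^ v \<and> (\<forall>i\<in>I. bit t i = \<beta> i)} = X (\<beta> j) \<union> X (\<not> \<beta> j)"
    by (auto simp: X_def)
  moreover have "X (\<beta> j) \<inter> X (\<not> \<beta> j) = {}" by (auto simp: X_def)
  ultimately have "2 ^ (v - card I) = 2 * card (X (\<beta> j))"
    using insert fin eq by (simp add: card_Un_disjoint)
  moreover have "card (insert j I) \<le> v"
    using card_mono[OF _ insert.prems] by simp
  then have "v - card I = Suc (v - card (insert j I))" using insert.hyps by simp
  ultimately have "card (X (\<beta> j)) = 2 ^ (v - card (insert j I))" by simp
  moreover have "X (\<beta> j) = {t::nat. t < 2 ^ v \<and> (\<forall>i\<in>insert j I. bit t i = \<beta> i)}"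
    by (auto simp: X_def)
  ultimately show ?case by simp
qed

text \<open>
  A sum of powers of one half over a set of indices is at most twice its largest term; with this,
  the maximum of several gains can be replaced by half of their sum.
\<close>

lemma geometric_tail_le:
  fixes P :: "nat \<Rightarrow> bool"
  assumes "\<And>i. P i \<Longrightarrow> i0 \<le> i"
  shows "(\<Sum>i<S. if P i then (1/2::real) ^ (i+1) else 0) \<le> (1/2) ^ i0"
proof -
  have "(\<Sum>i<S. if P i then (1/2::real) ^ (i+1) else 0) \<le> (\<Sum>i<S. if i0 \<le> i then (1/2::real) ^ (i+1) else 0)"
    using assms by (intro sum_mono) auto
  also have "\<dots> \<le> (1/2)^i0 - (if i0 \<le> S then (1/2)^S else (1/2)^i0)"
  proof (induction S)
    case 0
    show ?case by (cases i0) auto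
  next
    case (Suc S)
    consider "i0 \<le> S" | "i0 = Suc S" | "Suc S < i0" by linarith
    then show ?case using Suc by cases auto
  qed
  also have "\<dots> \<le> (1/2) ^ i0" by simp
  finally show ?thesis .
qed

lemma exp_minus_le_half:
  assumes "0 \<le> (u::real)" "u \<le> 1"
  shows "exp (-u) \<le> 1 - u/2"
proof -
  have "exp (-u) * (1 + u) \<le> 1"
    using exp_ge_add_one_self[of u] by (simp add: exp_minus field_simps)
  moreover have "1 \<le> (1 - u/2) * (1 + u)"
  proof -
    have "(1 - u/2) * (1 + u) = 1 + u * (1 - u) / 2" by (simp add: field_simps)
    then show ?thesis using assms by simp
  qed
  ultimately have "exp (-u) * (1 + u) \<le> (1 - u/2) * (1 + u)" by linarith
  then show ?thesis using assms by (simp add: mult_le_cancel_right)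
qed

section \<open>A sparse pattern that looks dense at a random scale\<close>

text \<open>
  The pattern \<open>B\<close> has density \<open>2\<^sup>-\<^sup>S\<close>, but for each \<open>t\<close> there is a scale \<open>2 ^ (e + d t)\<close> at which a
  window starting after \<open>t\<close> sees density at least \<open>a t\<close>, with \<open>a\<close> of mean at least \<open>S / 2 ^ (S + 3)\<close>.
  The gain \<open>a\<close> occurs only through the mean of \<open>exp (- a t)\<close>, since that is multiplicative when
  patterns are stacked. The density has to persist for window lengths in a range of ratio \<open>2 ^ r\<close>, to
  leave room for the scales of the patterns that are inserted later. All scales start at
  \<open>2 ^ e\<close> and stay inside a range of ratio \<open>2 ^ (S * (r + 3))\<close>.
\<close>

lemma multiscale_bit_pattern:
  fixes S r e v :: nat
  assumes S: "0 < S" and v: "e + S * (r + 3) \<le> v"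
  obtains B :: "nat \<Rightarrow> bool" and a :: "nat \<Rightarrow> real" and d :: "nat \<Rightarrow> nat" where
    "card {t. t < 2 ^ v \<and> B t} = 2 ^ (v - S)"
    "\<And>t. d t + r \<le> S * (r + 3)"
    "\<And>t n. t < 2 ^ v \<Longrightarrow> 2 ^ (e + d t) \<le> n \<Longrightarrow> n \<le> 2 ^ (e + d t + r) \<Longrightarrow>
       a t * real n \<le> card {k \<in> {1..n}. t + k < 2 ^ v \<and> B (t + k)}"
    "(\<Sum>t<2^v. exp (- a t)) \<le> 2 ^ v * (1 - S / 2 ^ (S + 4))"
proof -
  (* The S prescribed digits c 0 < ... < c (S - 1) are w places apart. A point t is labelled i (L i t)
     if all its prescribed digits from c i upwards are one. Windows of lengths between
     2 ^ (e + i * w) and 2 ^ (e + i * w + r) are then at least twice the period 2 ^ (c (i - 1) + 1)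
     of the lower prescribed digits, and too short to change the higher ones: the digit just
     below c i is required to be zero, so that adding the window length causes no carry into c i.
     The least label gives the largest density. *)
  define w where "w = r + 3"
  define c where "c i = e + i * w + r + 1" for i
  define B where "B t \<longleftrightarrow> (\<forall>i\<in>{..<S}. bit t (c i))" for t :: nat
  define L where "L i t \<longleftrightarrow> i < S \<and> (\<forall>j. i \<le> j \<and> j < S \<longrightarrow> bit t (c j)) \<and> \<not> bit t (e + i * w + r)" for i and t :: nat
  define i0 where "i0 t = (LEAST i. L i t)" for t
  define a where "a t = (if \<exists>i. L i t then (1/2::real) ^ (i0 t + 1) else 0)" for t
  define d where "d t = (if \<exists>i. L i t then i0 t * w else 0)" for t

  have c_mono: "c i < c j \<longleftrightarrow> i < j" for i j by (simp add: c_def w_def)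
  have c_inj: "inj_on c A" for A by (rule inj_onI) (auto simp: c_def w_def)
  have Sw: "i * w + w \<le> S * w" if "i < S" for i
    using mult_le_mono1[of "Suc i" S w] that by simp
  have c_less: "c i < v" if "i < S" for i
    using Sw[OF that] v by (simp add: c_def w_def)

  have cardB: "card {t. t < 2 ^ v \<and> B t} = 2 ^ (v - S)"
  proof -
    have "card {t::nat. t < 2 ^ v \<and> (\<forall>i\<in>c ` {..<S}. bit t i = True)} = 2 ^ (v - card (c ` {..<S}))"
      by (rule card_prescribed_bits) (auto simp: c_less)
    then show ?thesis by (simp add: B_def card_image[OF c_inj])
  qed

  have cardL: "card {t. t < 2 ^ v \<and> L i t} = 2 ^ (v - (S - i) - 1)" if i: "i < S" for i
  proof -
    let ?z = "e + i * w + r"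
    let ?I = "insert ?z (c ` {i..<S})"
    have cz: "c j \<noteq> ?z" if "i \<le> j" for j
      using mult_le_mono1[OF that, of w] unfolding c_def by linarith
    have z: "?z \<notin> c ` {i..<S}" using cz by force
    have "card {t::nat. t < 2 ^ v \<and> (\<forall>k\<in>?I. bit t k = (k \<noteq> ?z))} = 2 ^ (v - card ?I)"
      using c_less c_less[OF i] by (intro card_prescribed_bits) (auto simp: c_def)
    moreover have "{t::nat. t < 2 ^ v \<and> (\<forall>k\<in>?I. bit t k = (k \<noteq> ?z))} = {t. t < 2 ^ v \<and> L i t}"
      using cz i by (auto simp: L_def)
    ultimately show ?thesis
      using z by (simp add: card_image[OF c_inj])
  qed

  have window: "(1/2) ^ (i+1) * real n \<le> real (card {k \<in> {1..n}. t + k < 2 ^ v \<and> B (t + k)})"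
    if t: "t < 2 ^ v" and L: "L i t" and n: "2 ^ (e + i * w) \<le> n" "n \<le> 2 ^ (e + i * w + r)" for i t and n :: nat
  proof -
    let ?z = "e + i * w + r"
    have i: "i < S" using L by (simp add: L_def)
    \<comment> \<open>The zero digit at \<open>?z\<close> absorbs the carry, so the digits above it are constant on the window.\<close>
    have high: "bit (t + k) j \<longleftrightarrow> bit t j" if "k \<le> n" "?z < j" for k j :: nat
    proof -
      have "take_bit (Suc ?z) t = take_bit ?z t"
        using L by (simp add: L_def take_bit_Suc_from_most)
      then have "take_bit (Suc ?z) t < 2 ^ ?z" by simp
      then have "t mod 2 ^ Suc ?z + k < 2 ^ Suc ?z"
        using that(1) n(2) by (simp add: take_bit_eq_mod)
      moreover have "t + k = (t div 2 ^ Suc ?z) * 2 ^ Suc ?z + (t mod 2 ^ Suc ?z + k)"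
        using div_mult_mod_eq[of t "2 ^ Suc ?z"] by linarith
      ultimately have "(t + k) div 2 ^ Suc ?z = t div 2 ^ Suc ?z"
        by (metis add.commute add_0 div_less div_mult_self1 power_not_zero zero_neq_numeral)
      then have "drop_bit (Suc ?z) (t + k) = drop_bit (Suc ?z) t"
        by (simp add: drop_bit_eq_div)
      then have "bit (drop_bit (Suc ?z) (t + k)) (j - Suc ?z) = bit (drop_bit (Suc ?z) t) (j - Suc ?z)"
        by simp
      then show ?thesis using that(2) by (simp add: bit_drop_bit_eq)
    qed
    have zc: "?z < c j" if "i \<le> j" for j
      using mult_le_mono1[OF that, of w] unfolding c_def by linarith
    have zv: "?z < v" using zc[of i] c_less[OF i] by simp
    define Low where "Low x \<longleftrightarrow> (\<forall>j\<in>{..<i}. bit x (c j))" for x :: nat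
    have in_tower: "t + k < 2 ^ v" if "k \<le> n" for k
      using t high[OF that] zv by (simp add: less_two_power_iff_bits)
    have BLow: "B (t + k)" if "k \<le> n" "Low (t + k)" for k
      unfolding B_def
    proof
      fix j assume "j \<in> {..<S}" then have "j < S" by simp
      show "bit (t + k) (c j)"
      proof (cases "j < i")
        case True then show ?thesis using that by (simp add: Low_def)
      next
        case False
        then show ?thesis using high[OF that(1) zc] L \<open>j < S\<close> by (simp add: L_def)
      qed
    qed
    have sub: "card {k \<in> {1..n}. Low (t + k)} \<le> card {k \<in> {1..n}. t + k < 2 ^ v \<and> B (t + k)}"
      by (rule card_mono) (use in_tower BLow in auto)
    have "(1/2) ^ (i+1) * real n \<le> real (card {k \<in> {1..n}. Low (t + k)})"
    proof (cases i)
      case 0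
      have "{k \<in> {1..n}. Low (t + k)} = {1..n}" using 0 by (auto simp: Low_def)
      then show ?thesis using 0 by simp
    next
      case (Suc i')
      define q where "q = Suc (c i')"
      have q: "Suc q = e + i * w" using Suc by (simp add: q_def c_def w_def)
      have cq: "c j < q" if "j < i" for j
        using c_mono[of j i'] that Suc by (cases "j = i'") (auto simp: q_def less_Suc_eq)
      have LowT: "Low (x mod 2 ^ q) \<longleftrightarrow> Low x" for x
        using cq by (simp add: Low_def flip: take_bit_eq_mod) (simp add: bit_take_bit_iff)
      have "card {k::nat. k < 2 ^ q \<and> (\<forall>j\<in>c ` {..<i}. bit k j = True)} = 2 ^ (q - card (c ` {..<i}))"
        by (rule card_prescribed_bits) (auto simp: cq)
      then have cardLow: "card {k. k < 2 ^ q \<and> Low k} = 2 ^ (q - i)"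
        by (simp add: Low_def card_image[OF c_inj])
      have iq: "i \<le> q" 
      proof -
        have "card (c ` {..<i}) \<le> card {..<q}" by (rule card_mono) (auto simp: cq)
        then show ?thesis by (simp add: card_image[OF c_inj])
      qed
      \<comment> \<open>At least half of the window consists of whole periods of the lower prescribed digits.\<close>
      have "(n div 2 ^ q) * 2 ^ (q - i) \<le> card {k \<in> {1..n}. Low (t + k)}"
        by (rule card_mod_window[of "2 ^ q" n Low t, unfolded LowT cardLow]) (rule zero_less_power, rule pos2)
      from of_nat_mono[OF this, where 'a = real]
      have *: "real (n div 2 ^ q) * 2 ^ (q - i) \<le> card {k \<in> {1..n}. Low (t + k)}"
        unfolding of_nat_mult of_nat_power of_nat_numeral .
      have "2 * 2 ^ q \<le> n" using n(1) unfolding q[symmetric] power_Suc .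
      then have "n \<le> 2 * (n div 2 ^ q) * 2 ^ q"
      proof -
        have "n = n div 2 ^ q * 2 ^ q + n mod 2 ^ q" by (rule div_mult_mod_eq[symmetric])
        moreover have "n mod 2 ^ q < 2 ^ q" by simp
        ultimately have "n < n div 2 ^ q * 2 ^ q + 2 ^ q" by linarith
        then show ?thesis using \<open>2 * 2 ^ q \<le> n\<close> by linarith
      qed
      from of_nat_mono[OF this, where 'a = real]
      have "real n \<le> 2 * real (n div 2 ^ q) * 2 ^ q"
        unfolding of_nat_mult of_nat_power of_nat_numeral .
      then have "(1/2) ^ (i+1) * real n \<le> (1/2) ^ (i+1) * (2 * real (n div 2 ^ q) * 2 ^ q)"
        by (intro mult_left_mono) auto
      also have "\<dots> = real (n div 2 ^ q) * 2 ^ (q - i)"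
        using iq by (simp add: power_diff power_one_over field_simps)
      finally show ?thesis using * by linarith
    qed
    then show ?thesis using sub by linarith
  qed

  have Li0: "L (i0 t) t" if "L i t" for i t
    unfolding i0_def using that by (rule LeastI)
  have i0_le: "i0 t \<le> i" if "L i t" for i t
    unfolding i0_def using that by (rule Least_le)
  have a01: "0 \<le> a t" "a t \<le> 1" for t
    by (auto simp: a_def simp del: power_Suc intro!: power_le_one)
  have d1: "d t + r \<le> S * (r+3)" for t
  proof (cases "\<exists>i. L i t")
    case True
    then have "i0 t < S" using Li0 by (auto simp: L_def)
    from Sw[OF this] True show ?thesis by (simp add: d_def w_def)
  next
    case False
    have "d t = 0" using False by (simp add: d_def)
    then show ?thesis using Sw[OF S] unfolding w_def by linarith
  qed
  have a_window: "a t * real n \<le> card {k \<in> {1..n}. t + k < 2 ^ v \<and> B (t + k)}"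
    if "t < 2 ^ v" "2 ^ (e + d t) \<le> n" "n \<le> 2 ^ (e + d t + r)" for t and n :: nat
  proof (cases "\<exists>i. L i t")
    case True
    then show ?thesis using window[of t "i0 t" n] Li0 that by (auto simp: a_def d_def)
  qed (simp add: a_def)

  \<comment> \<open>The gain is the largest of the terms for the single labels, hence at least half of their sum,
    and each label contributes the same amount to the mean of that sum.\<close>
  have a_ge: "(\<Sum>i<S. if L i t then (1/2::real) ^ (i+1) else 0) \<le> 2 * a t" for t
  proof (cases "\<exists>i. L i t")
    case True
    then show ?thesis
      using geometric_tail_le[of "\<lambda>i. L i t" "i0 t" S] i0_le by (simp add: a_def)
  qed (simp add: a_def)
  have total: "(\<Sum>t<2^v. \<Sum>i<S. if L i t then (1/2::real) ^ (i+1) else 0) = 2 ^ v * (S / 2 ^ (S+2))"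
  proof -
    have "(\<Sum>t<2^v. \<Sum>i<S. if L i t then (1/2::real) ^ (i+1) else 0) =
        (\<Sum>i<S. \<Sum>t<2^v. if L i t then (1/2::real) ^ (i+1) else 0)"
      by (rule sum.swap)
    also have "\<dots> = (\<Sum>i<S. 2 ^ v / 2 ^ (S + 2))"
    proof (rule sum.cong[OF refl])
      fix i assume "i \<in> {..<S}"
      then have i: "i < S" by simp
      have Sv: "S - i + 1 \<le> v"
      proof -
        have "S * 1 \<le> S * w" by (rule mult_le_mono2) (simp add: w_def)
        moreover have "S * w = S * 3 + S * r" by (simp add: w_def algebra_simps)
        ultimately show ?thesis using v i by (simp add: algebra_simps)
      qed
      have "(\<Sum>t<2^v. if L i t then (1/2::real) ^ (i+1) else 0) = card {t. t < 2 ^ v \<and> L i t} * (1/2) ^ (i+1)"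
        by (simp add: sum.If_cases Int_def)
      also have "\<dots> = 2 ^ (v - (S - i + 1)) * (1/2) ^ (i+1)"
        using cardL[OF i] by simp
      also have "\<dots> = 2 ^ v / 2 ^ (S - i + 1 + (i + 1))"
        using Sv by (simp only: power_diff power_add) (simp add: power_one_over field_simps)
      also have "S - i + 1 + (i + 1) = S + 2" using i by simp
      finally show "(\<Sum>t<2^v. if L i t then (1/2::real) ^ (i+1) else 0) = 2 ^ v / 2 ^ (S + 2)" .
    qed
    finally show ?thesis by simp
  qed
  have "2 ^ v * (S / 2 ^ (S+2)) \<le> (\<Sum>t<2^v. 2 * a t)"
    unfolding total[symmetric] by (intro sum_mono a_ge)
  then have suma: "2 ^ v * (S / 2 ^ (S+2)) \<le> 2 * (\<Sum>t<2^v. a t)"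
    by (simp add: sum_distrib_left)
  have "(\<Sum>t<2^v. exp (- a t)) \<le> (\<Sum>t<2^v. 1 - a t / 2)"
    by (intro sum_mono exp_minus_le_half a01)
  also have "\<dots> = 2 ^ v - (\<Sum>t<2^v. a t) / 2"
    by (simp add: sum_subtractf sum_divide_distrib)
  also have "\<dots> \<le> 2 ^ v * (1 - S / 2 ^ (S + 4))"
    using suma by (simp add: field_simps power_add)
  finally have sumexp: "(\<Sum>t<2^v. exp (- a t)) \<le> 2 ^ v * (1 - S / 2 ^ (S + 4))" .
  show ?thesis by (rule that[OF cardB d1 a_window sumexp])
qed

section \<open>Stacking patterns on a cycle\<close>

text \<open>
  This says \<open>N\<^sub>n(u) \<ge> c n\<close> for \<open>N\<^sub>n(u) = #{k \<ge> 1. u k / k \<ge> 1 / n}\<close>. The count is expressed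
  by a finite subset because the set itself may be infinite, and \<^const>\<open>card\<close> would then be \<open>0\<close>.
\<close>

definition tail_count_ge :: "(nat \<Rightarrow> real) \<Rightarrow> nat \<Rightarrow> real \<Rightarrow> bool" where
  "tail_count_ge u n c \<longleftrightarrow>
     (\<exists>D. finite D \<and> D \<subseteq> {k. 1 \<le> k \<and> real k \<le> real n * u k} \<and> c * real n \<le> real (card D))"

text \<open>
  A function \<open>f\<close> on a cycle of length \<open>m\<close>, of mean at most \<open>c\<close>, together with a score \<open>s x\<close> for
  each point, which the counting ratio along the orbit of \<open>x\<close> reaches for all \<open>n\<close> in
  a range of ratio \<open>2 ^ r\<close> starting at \<open>2 ^ e x\<close>. The bound \<open>z\<close> on the mean of \<open>exp (- s x)\<close> records
  that scores are large for most points.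
\<close>

definition scored_cycle :: "nat \<Rightarrow> real \<Rightarrow> real \<Rightarrow> bool" where
  "scored_cycle r c z \<longleftrightarrow> (\<exists>(m::nat) (f::nat \<Rightarrow> nat) e s. 0 < m \<and> (\<forall>x. f (x + m) = f x) \<and>
     real (\<Sum>x<m. f x) \<le> c * real m \<and> (\<Sum>x<m. exp (- s x)) \<le> z * real m \<and>
     (\<forall>x<m. \<forall>n. 2 ^ e x \<le> n \<longrightarrow> n \<le> 2 ^ (e x + r) \<longrightarrow>
        tail_count_ge (\<lambda>k. real (f (x + k))) n (s x)))"

lemma sum_over_towers:
  fixes g :: "nat \<Rightarrow> 'a :: comm_monoid_add"
  shows "(\<Sum>y<m * V. g y) = (\<Sum>x<m. \<Sum>t<V. g (x * V + t))"
proof -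
  have "(\<Sum>y<m * V. g y) = (\<Sum>x<m. \<Sum>y\<in>{x * V..<x * V + V}. g y)"
    by (rule sum.nat_group[symmetric])
  also have "\<dots> = (\<Sum>x<m. \<Sum>t<V. g (x * V + t))"
  proof (rule sum.cong[OF refl])
    fix x
    show "(\<Sum>y\<in>{x * V..<x * V + V}. g y) = (\<Sum>t<V. g (x * V + t))"
      by (rule sum.reindex_bij_witness[of _ "\<lambda>t. x * V + t" "\<lambda>y. y - x * V"]) auto
  qed
  finally show ?thesis .
qed

text \<open>
  Points \<open>y = x * V + t\<close> of the new cycle are height \<open>t\<close> in the tower over \<open>x\<close>. A visit of the old
  orbit at time \<open>k\<close> with \<open>k \<le> n * f (x + k)\<close> becomes a visit to a base at time \<open>k * V - t \<le> k * V\<close>, where the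
  new function is \<open>V\<close> times as large, so it is still counted for the same \<open>n\<close>. The pattern has value \<open>1\<close>
  and is counted up to time \<open>n\<close>, as long as the orbit stays in the tower over \<open>x\<close>, whose pattern has
  its scales in the good range of \<open>x\<close>; the gain refers to exactly these visits.
  Both counts are taken at disjoint times: bases for the old one, interior points for the new one.
\<close>

lemma scored_cycle_step:
  assumes S: "0 < S" and R: "scored_cycle (S * (r + 3)) c z"
  shows "scored_cycle r (c + 1 / 2 ^ S) (z * (1 - S / 2 ^ (S + 4)))"
proof -
  define R' where "R' = S * (r + 3)"
  define \<rho> where "\<rho> = (1 - real S / 2 ^ (S + 4))"
  obtain m and f e :: "nat \<Rightarrow> nat" and s :: "nat \<Rightarrow> real" where m: "0 < m" and per: "\<And>x. f (x + m) = f x"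
    and fsum: "real (\<Sum>x<m. f x) \<le> c * m" and ssum: "(\<Sum>x<m. exp (- s x)) \<le> z * m"
    and cnt: "\<And>x n. x < m \<Longrightarrow> 2 ^ e x \<le> n \<Longrightarrow> n \<le> 2 ^ (e x + R') \<Longrightarrow>
        tail_count_ge (\<lambda>k. real (f (x + k))) n (s x)"
    using R unfolding scored_cycle_def R'_def by blast
  define v where "v = (\<Sum>x<m. e x) + R'"
  define V :: nat where "V = 2 ^ v"
  have V: "0 < V" by (simp add: V_def)
  have ev: "e x + R' \<le> v" if "x < m" for x
    using member_le_sum[of x "{..<m}" e] that by (simp add: v_def)
  have Sv: "S \<le> v" using mult_le_mono2[of 1 "r+3" S] unfolding v_def R'_def by linarith
  define P where "P x B a d \<longleftrightarrow> card {t. t < V \<and> B t} = 2 ^ (v - S) \<and> (\<forall>t. d t + r \<le> R') \<and>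
      (\<forall>t n. t < V \<longrightarrow> 2 ^ (e x + d t) \<le> n \<longrightarrow> n \<le> 2 ^ (e x + d t + r) \<longrightarrow>
         a t * real n \<le> card {k \<in> {1..n}. t + k < V \<and> B (t + k)}) \<and>
      (\<Sum>t<V. exp (- a t)) \<le> V * \<rho>" for x :: nat and B a d
  have "\<exists>B a d. P x B a d" if x: "x < m" for x
  proof -
    obtain B :: "nat \<Rightarrow> bool" and a :: "nat \<Rightarrow> real" and d :: "nat \<Rightarrow> nat" where
      "card {t. t < 2 ^ v \<and> B t} = 2 ^ (v - S)" "\<And>t. d t + r \<le> S * (r + 3)"
      "\<And>t n. t < 2 ^ v \<Longrightarrow> 2 ^ (e x + d t) \<le> n \<Longrightarrow> n \<le> 2 ^ (e x + d t + r) \<Longrightarrow>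
         a t * real n \<le> card {k \<in> {1..n}. t + k < 2 ^ v \<and> B (t + k)}"
      "(\<Sum>t<2^v. exp (- a t)) \<le> 2 ^ v * (1 - S / 2 ^ (S + 4))"
      by (rule multiscale_bit_pattern[OF S ev[OF x, unfolded R'_def]]) blast
    then have "P x B a d" unfolding P_def V_def R'_def \<rho>_def of_nat_power of_nat_numeral by blast
    then show ?thesis by blast
  qed
  then obtain B a d where P: "\<And>x. x < m \<Longrightarrow> P x (B x) (a x) (d x)" by metis

  \<comment> \<open>The reduction modulo \<open>m\<close> makes \<open>F\<close> periodic: the patterns are chosen only for \<open>x < m\<close>.\<close>
  define F where "F y = (if V dvd y then V * f (y div V)
      else if B ((y div V) mod m) (y mod V) then 1 else 0)" for y
  define E where "E y = e (y div V) + d (y div V) (y mod V)" for y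
  define \<sigma> where "\<sigma> y = s (y div V) + a (y div V) (y mod V)" for y

  have Fper: "F (y + m * V) = F y" for y
  proof -
    have "V dvd y + m * V \<longleftrightarrow> V dvd y" by simp
    moreover have "(y + m * V) div V = y div V + m" "(y + m * V) mod V = y mod V" using V by simp_all
    ultimately show ?thesis using per[of "y div V"] by (simp add: F_def)
  qed

  have Fsum: "real (\<Sum>y<m * V. F y) \<le> (c + 1 / 2 ^ S) * (m * V)"
  proof -
    have "(\<Sum>t<V. F (x * V + t)) \<le> V * f x + 2 ^ (v - S)" if x: "x < m" for x
    proof -
      have "F (x * V + t) \<le> (if t = 0 then V * f x else 0) + (if B x t then 1 else 0)" if "t < V" for t
        using that x V by (auto simp: F_def dvd_eq_mod_eq_0)
      then have "(\<Sum>t<V. F (x * V + t)) \<le> (\<Sum>t<V. (if t = 0 then V * f x else 0) + (if B x t then 1 else 0))"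
        by (intro sum_mono) auto
      also have "\<dots> = V * f x + card {t. t < V \<and> B x t}"
        using V by (simp add: sum.distrib sum.If_cases Int_def)
      finally show ?thesis using P[OF x] by (simp add: P_def)
    qed
    then have "(\<Sum>y<m * V. F y) \<le> (\<Sum>x<m. V * f x + 2 ^ (v - S))"
      unfolding sum_over_towers by (intro sum_mono) auto
    also have "\<dots> = V * (\<Sum>x<m. f x) + m * 2 ^ (v - S)"
      by (simp add: sum.distrib sum_distrib_left)
    finally have "real (\<Sum>y<m * V. F y) \<le> real (V * (\<Sum>x<m. f x) + m * 2 ^ (v - S))"
      by (rule of_nat_mono)
    also have "\<dots> = V * real (\<Sum>x<m. f x) + m * (V / 2 ^ S)"
    proof -
      have "(2::real) ^ (v - S) = V / 2 ^ S"
        using Sv power_diff[of "2::real" S v] by (simp add: V_def)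
      then show ?thesis by simp
    qed
    also have "\<dots> \<le> V * (c * m) + m * (V / 2 ^ S)"
      using fsum V by (intro add_mono mult_left_mono) auto
    also have "\<dots> = (c + 1 / 2 ^ S) * (m * V)" by (simp add: algebra_simps)
    finally show ?thesis .
  qed

  have \<sigma>sum: "(\<Sum>y<m * V. exp (- \<sigma> y)) \<le> (z * \<rho>) * (m * V)"
  proof -
    have "(\<Sum>t<V. exp (- \<sigma> (x * V + t))) \<le> exp (- s x) * (V * \<rho>)" if x: "x < m" for x
    proof -
      have "(\<Sum>t<V. exp (- \<sigma> (x * V + t))) = (\<Sum>t<V. exp (- s x) * exp (- a x t))"
        by (rule sum.cong) (auto simp: \<sigma>_def exp_add[symmetric])
      also have "\<dots> = exp (- s x) * (\<Sum>t<V. exp (- a x t))" by (simp add: sum_distrib_left)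
      also have "\<dots> \<le> exp (- s x) * (V * \<rho>)"
        using P[OF x] by (intro mult_left_mono) (auto simp: P_def)
      finally show ?thesis .
    qed
    then have "(\<Sum>y<m * V. exp (- \<sigma> y)) \<le> (\<Sum>x<m. exp (- s x) * (V * \<rho>))"
      unfolding sum_over_towers by (intro sum_mono) auto
    also have "\<dots> = (\<Sum>x<m. exp (- s x)) * (V * \<rho>)" by (simp add: sum_distrib_right)
    also have "\<dots> \<le> (z * m) * (V * \<rho>)"
    proof (intro mult_right_mono ssum)
      have "0 \<le> (\<Sum>t<V. exp (- a 0 t))" by (intro sum_nonneg) auto
      also have "\<dots> \<le> V * \<rho>" using P[OF m] by (simp add: P_def)
      finally show "0 \<le> V * \<rho>" .
    qed
    finally show ?thesis by (simp add: algebra_simps)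
  qed

  have Fcnt: "tail_count_ge (\<lambda>k. real (F (y + k))) n (\<sigma> y)"
    if y: "y < m * V" and n: "2 ^ E y \<le> n" "n \<le> 2 ^ (E y + r)" for y n
  proof -
    define x where "x = y div V"
    define t where "t = y mod V"
    have yxt: "y = x * V + t" by (simp add: x_def t_def)
    have x: "x < m" using y V by (simp add: x_def less_mult_imp_div_less)
    have t: "t < V" using V by (simp add: t_def)
    have Ey: "E y = e x + d x t" by (simp add: E_def x_def t_def)
    have \<sigma>y: "\<sigma> y = s x + a x t" by (simp add: \<sigma>_def x_def t_def)
    have dR: "d x t + r \<le> R'" using P[OF x] by (simp add: P_def)
    have "2 ^ e x \<le> n" using n(1) order_trans[of "2 ^ e x" "2 ^ E y" n] by (simp add: Ey)
    moreover have "n \<le> 2 ^ (e x + R')"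
      using n(2) dR by (intro order_trans[OF n(2)] power_increasing) (auto simp: Ey)
    ultimately obtain D where D: "finite D" "D \<subseteq> {k. 1 \<le> k \<and> real k \<le> real n * real (f (x + k))}"
      "s x * real n \<le> real (card D)"
      using cnt[OF x] unfolding tail_count_ge_def by blast
    define D1 where "D1 = (\<lambda>k. k * V - t) ` D"
    define D2 where "D2 = {k \<in> {1..n}. t + k < V \<and> B x (t + k)}"
    have D2: "a x t * real n \<le> card D2"
      using P[OF x] t n unfolding P_def D2_def Ey by blast
    have kV: "t < k * V" if "k \<in> D" for k
    proof -
      have "1 * V \<le> k * V" using D(2) that by (intro mult_le_mono1) auto
      then show ?thesis using t by linarith
    qed
    have "inj_on (\<lambda>k. k * V - t) D"
    proof (rule inj_onI)
      fix k l assume "k \<in> D" "l \<in> D" "k * V - t = l * V - t"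
      then have "k * V = l * V" using kV[of k] kV[of l] by linarith
      then show "k = l" using V by simp
    qed
    then have cardD1: "card D1 = card D" by (simp add: D1_def card_image)
    have yD1: "y + (k * V - t) = (x + k) * V" if "k \<in> D" for k
      using kV[OF that] by (simp add: yxt algebra_simps)
    have "D1 \<inter> D2 = {}"
    proof -
      have "\<not> V dvd y + k" if "k \<in> D2" for k
      proof -
        have "(y + k) mod V = (x * V + (t + k)) mod V" by (simp add: yxt add.assoc)
        also have "\<dots> = t + k" using that by (simp add: D2_def)
        finally show ?thesis using that by (simp add: D2_def dvd_eq_mod_eq_0)
      qed
      moreover have "V dvd y + k" if "k \<in> D1" for k
        using that yD1 by (auto simp: D1_def)
      ultimately show ?thesis by blast
    qed
    then have card: "card (D1 \<union> D2) = card D + card D2"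
      using D(1) cardD1 by (subst card_Un_disjoint) (auto simp: D1_def D2_def)
    have "1 \<le> k \<and> real k \<le> real n * real (F (y + k))" if "k \<in> D1" for k
    proof -
      obtain l where l: "l \<in> D" "k = l * V - t" using \<open>k \<in> D1\<close> by (auto simp: D1_def)
      have "F (y + k) = V * f (x + l)" unfolding l(2) yD1[OF l(1)] using V by (simp add: F_def)
      moreover have "real k \<le> real l * V"
        using l(2) of_nat_mono[of k "l * V", where 'a = real] by simp
      moreover have "real l * V \<le> real n * real (f (x + l)) * V"
        using D(2) l(1) by (intro mult_right_mono) auto
      ultimately show ?thesis using kV[OF l(1)] l(2) by (simp add: algebra_simps)
    qed
    moreover have "1 \<le> k \<and> real k \<le> real n * real (F (y + k))" if "k \<in> D2" for k
    proof -
      have yk: "y + k = x * V + (t + k)" by (simp add: yxt add.assoc)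
      have tk: "t + k < V" "0 < t + k" using that by (auto simp: D2_def)
      have "(y + k) mod V = t + k" "(y + k) div V = x" unfolding yk using tk(1) by simp_all
      then have "F (y + k) = 1" using that tk x by (simp add: F_def D2_def dvd_eq_mod_eq_0)
      then show ?thesis using that by (simp add: D2_def)
    qed
    ultimately have "D1 \<union> D2 \<subseteq> {k. 1 \<le> k \<and> real k \<le> real n * real (F (y + k))}" by blast
    moreover have "finite (D1 \<union> D2)" using D(1) by (simp add: D1_def D2_def)
    moreover have "\<sigma> y * real n \<le> real (card (D1 \<union> D2))"
      using D(3) D2 by (simp add: card \<sigma>y algebra_simps)
    ultimately show ?thesis unfolding tail_count_ge_def by blast
  qed

  have "0 < m * V" using m V by simp
  then show ?thesis
    unfolding scored_cycle_def \<rho>_def[symmetric]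
    using Fper Fsum \<sigma>sum Fcnt
    by (intro exI[of _ "m * V"] exI[of _ F] exI[of _ E] exI[of _ \<sigma>]) auto
qed

lemma scored_cycle_power:
  assumes "0 < S"
  shows "scored_cycle r (real K / 2 ^ S) ((1 - S / 2 ^ (S + 4)) ^ K)"
proof (induction K arbitrary: r)
  case 0
  have "tail_count_ge u n 0" for u n
    unfolding tail_count_ge_def by (intro exI[of _ "{}"]) auto
  then show ?case
    unfolding scored_cycle_def
    by (intro exI[of _ 1] exI[of _ "\<lambda>_. 0"]) (auto simp: lessThan_Suc)
next
  case (Suc K)
  from scored_cycle_step[OF assms Suc[of "S * (r + 3)"]] show ?case
    by (simp add: add_divide_distrib algebra_simps)
qed

lemma tail_count_ge_mono:
  assumes "tail_count_ge u n c" "c' \<le> c" "\<And>k. u k \<le> u' k"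
  shows "tail_count_ge u' n c'"
proof -
  obtain D where D: "finite D" "D \<subseteq> {k. 1 \<le> k \<and> real k \<le> real n * u k}" "c * real n \<le> real (card D)"
    using assms(1) unfolding tail_count_ge_def by blast
  have "D \<subseteq> {k. 1 \<le> k \<and> real k \<le> real n * u' k}"
  proof
    fix k assume "k \<in> D"
    then have "1 \<le> k" "real k \<le> real n * u k" using D(2) by auto
    moreover have "real n * u k \<le> real n * u' k" using assms(3) by (intro mult_left_mono) auto
    ultimately show "k \<in> {k. 1 \<le> k \<and> real k \<le> real n * u' k}" by simp
  qed
  moreover have "c' * real n \<le> c * real n" using assms(2) by (intro mult_right_mono) auto
  ultimately show ?thesis using D unfolding tail_count_ge_def
    by (meson order_trans)
qed

text \<open>
  The maximal inequality for the counting function fails. With \<open>2 ^ S\<close> patterns of density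
  \<open>1 / 2 ^ S\<close> the mean is at most \<open>1\<close> and \<open>exp (-score)\<close> has mean at most
  \<open>(1 - S / 2 ^ (S + 4)) ^ (2 ^ S) \<le> exp (- S / 16)\<close>, so by Markov's inequality the score exceeds any
  prescribed bound outside a set of small proportion once \<open>S\<close> is large. Dividing the function by \<open>q\<close>
  and multiplying \<open>n\<close> by \<open>q\<close> leaves the count unchanged, so the mean can be made small at the price
  of a factor \<open>q\<close> in the score.
\<close>

lemma cyclic_counting_blowup:
  fixes L :: real and q :: nat and \<epsilon> :: real
  assumes "0 < \<epsilon>"  "0 < q"
  obtains m and f :: "nat \<Rightarrow> real" where "0 < m" "\<And>x. f (x + m) = f x" "\<And>x. 0 \<le> f x"
    "(\<Sum>x<m. f x) \<le> m / q"
    "real (card {x. x < m \<and> (\<forall>n\<ge>1. \<not> tail_count_ge (\<lambda>k. f (x + k)) n L)}) \<le> \<epsilon> * m"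
proof -
  define M where "M = L * q"
  \<comment> \<open>The score needed before the division by \<open>q\<close> is \<open>M\<close>; this \<open>S\<close> makes
    the exceptional proportion \<open>exp (M - S / 16)\<close> at most \<open>\<epsilon>\<close>.\<close>
  obtain S :: nat where S: "0 < S" "M - S / 16 \<le> ln \<epsilon>"
  proof -
    obtain S :: nat where "16 * (M - ln \<epsilon>) < S" using reals_Archimedean2 by blast
    then show ?thesis using that[of "Suc S"] by (simp add: field_simps)
  qed
  have "scored_cycle 0 (real (2 ^ S) / 2 ^ S) ((1 - S / 2 ^ (S + 4)) ^ (2 ^ S))"
    by (rule scored_cycle_power[OF S(1)])
  then obtain m and g e :: "nat \<Rightarrow> nat" and s :: "nat \<Rightarrow> real" where m: "0 < m" and per: "\<forall>x. g (x + m) = g x"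
    and gsum: "real (\<Sum>x<m. g x) \<le> real (2 ^ S) / 2 ^ S * real m"
    and ssum: "(\<Sum>x<m. exp (- s x)) \<le> (1 - S / 2 ^ (S + 4)) ^ (2 ^ S) * real m"
    and cnt0: "\<forall>x<m. \<forall>n. 2 ^ e x \<le> n \<longrightarrow> n \<le> 2 ^ (e x + 0) \<longrightarrow>
      tail_count_ge (\<lambda>k. real (g (x + k))) n (s x)"
    unfolding scored_cycle_def by blast
  have cnt: "tail_count_ge (\<lambda>k. real (g (x + k))) (2 ^ e x) (s x)" if "x < m" for x
    using cnt0 that unfolding add_0_right by blast
  define f where "f x = real (g x) / q" for x
  define Bad where "Bad = {x. x < m \<and> (\<forall>n\<ge>1. \<not> tail_count_ge (\<lambda>k. f (x + k)) n L)}"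

  have good: "tail_count_ge (\<lambda>k. f (x + k)) (q * 2 ^ e x) L" if x: "x < m" "M \<le> s x" for x
  proof -
    have "tail_count_ge (\<lambda>k. real (g (x + k))) (2 ^ e x) M"
      by (rule tail_count_ge_mono[OF cnt[OF x(1)] x(2) order_refl])
    moreover have "real (q * 2 ^ e x) * f (x + k) = real (2 ^ e x) * real (g (x + k))" for k
      using assms(2) by (simp add: f_def)
    moreover have "L * real (q * 2 ^ e x) = M * real (2 ^ e x)"
      by (simp add: M_def)
    ultimately show ?thesis
      unfolding tail_count_ge_def by (simp only:)
  qed
  have "(1 - S / 2 ^ (S + 4)) ^ (2 ^ S) \<le> exp (- (S / 2 ^ (S + 4))) ^ (2 ^ S)"
  proof (rule power_mono)
    show "1 - S / 2 ^ (S + 4) \<le> exp (- (S / 2 ^ (S + 4)))"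
      using exp_ge_add_one_self[of "- (S / 2 ^ (S + 4))"] by simp
    have "real S < 2 ^ S" by (rule of_nat_less_two_power)
    then have "real S \<le> 2 ^ S * 16" using of_nat_0_le_iff[of S, where 'a = real] by linarith
    then have "real S \<le> 2 ^ (S + 4)" by (simp add: power_add)
    then show "0 \<le> 1 - real S / 2 ^ (S + 4)" by simp
  qed
  also have "\<dots> = exp (2 ^ S * (- (S / 2 ^ (S + 4))))"
    by (subst exp_of_nat_mult[symmetric]) simp
  also have "2 ^ S * (- (S / 2 ^ (S + 4))) = - (real S / 16)"
    by (simp add: power_add)
  finally have ssum': "(\<Sum>x<m. exp (- s x)) \<le> exp (- (real S / 16)) * m"
    using ssum by (meson mult_right_mono of_nat_0_le_iff order_trans)
  have "card Bad * exp (- M) = (\<Sum>x\<in>Bad. exp (- M))" by simp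
  also have "\<dots> \<le> (\<Sum>x\<in>Bad. exp (- s x))"
  proof (rule sum_mono)
    fix x assume x: "x \<in> Bad"
    have "\<not> M \<le> s x"
    proof
      assume "M \<le> s x"
      with x good have "tail_count_ge (\<lambda>k. f (x + k)) (q * 2 ^ e x) L" by (simp add: Bad_def)
      moreover have "1 \<le> q * 2 ^ e x" using assms(2) by simp
      ultimately show False using x unfolding Bad_def by blast
    qed
    then show "exp (- M) \<le> exp (- s x)" by simp
  qed
  also have "\<dots> \<le> (\<Sum>x<m. exp (- s x))" by (rule sum_mono2) (auto simp: Bad_def)
  finally have "card Bad * exp (- M) \<le> exp (- (real S / 16)) * m" using ssum' by simp
  then have "(card Bad * exp (- M)) * exp M \<le> (exp (- (real S / 16)) * m) * exp M"
    by (rule mult_right_mono) simp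
  moreover have "(card Bad * exp (- M)) * exp M = card Bad"
    by (simp add: exp_minus)
  ultimately have "card Bad \<le> (exp (- (real S / 16)) * m) * exp M"
    by linarith
  also have "\<dots> = exp (M - S / 16) * m"
  proof -
    have "exp (M - S / 16) = exp (- (S / 16)) * exp M"
      by (subst exp_add[symmetric]) simp
    then show ?thesis by simp
  qed
  also have "\<dots> \<le> \<epsilon> * m"
  proof (rule mult_right_mono)
    have "exp (M - S / 16) \<le> exp (ln \<epsilon>)" using S(2) by simp
    then show "exp (M - S / 16) \<le> \<epsilon>" using assms(1) by simp
  qed simp
  finally have "real (card Bad) \<le> \<epsilon> * m" .
  moreover have "(\<Sum>x<m. f x) \<le> m / q"
    using gsum assms(2) by (simp add: f_def sum_divide_distrib[symmetric] divide_right_mono)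
  ultimately show ?thesis
    using that[of m f] m per[rule_format] by (simp add: Bad_def f_def)
qed

section \<open>Transport of systems to the real line\<close>

text \<open>
  An injection carries a system on any type to a system on its image, with the image sigma-algebra, so
  that no Borel isomorphism is needed: it is enough that the type embeds into the reals as a
  set. This allows the constructions to use sequence spaces.
\<close>

lemma embedded_system:
  fixes \<phi> :: "'a \<Rightarrow> 'b"
  assumes \<phi>: "inj \<phi>" and T: "measure_preserving_system M T"
  shows "measure_preserving_system (embed_measure M \<phi>) (\<lambda>x. \<phi> (T (inv \<phi> x)))"
proof -
  let ?E = "embed_measure M \<phi>" and ?T = "\<lambda>x. \<phi> (T (inv \<phi> x))"
  have P: "prob_space M" and bij: "bij_betw T (space M) (space M)"
    and Tm: "T \<in> measurable M M" and Ti: "the_inv_into (space M) T \<in> measurable M M"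
    and D: "distr M M T = M"
    using T by (auto simp: measure_preserving_system_def)
  have [simp]: "inv \<phi> (\<phi> x) = x" for x using \<phi> by simp
  have \<phi>m: "\<phi> \<in> measurable M ?E" by (rule measurable_embed_measure2[OF \<phi>])
  have E: "?E = distr M ?E \<phi>" by (rule embed_measure_eq_distr[OF \<phi>])
  have "prob_space ?E"
    by (subst E) (rule prob_space.prob_space_distr[OF P \<phi>m])
  moreover have b: "bij_betw ?T (space ?E) (space ?E)"
  proof -
    have b1: "bij_betw (inv \<phi>) (\<phi> ` space M) (space M)"
      by (rule bij_betw_byWitness[where f' = \<phi>]) auto
    have b2: "bij_betw \<phi> (space M) (\<phi> ` space M)"
      by (rule inj_on_imp_bij_betw) (rule inj_on_subset[OF \<phi> subset_UNIV])
    have "bij_betw (\<phi> \<circ> (T \<circ> inv \<phi>)) (\<phi> ` space M) (\<phi> ` space M)"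
      by (rule bij_betw_trans[OF bij_betw_trans[OF b1 bij] b2])
    then show ?thesis by (simp add: space_embed_measure o_def)
  qed
  moreover have Tm': "?T \<in> measurable ?E ?E"
    by (rule measurable_embed_measure1) (use measurable_compose[OF Tm \<phi>m] in simp)
  moreover have "the_inv_into (space ?E) ?T \<in> measurable ?E ?E"
  proof (rule measurable_embed_measure1)
    have "the_inv_into (space ?E) ?T (\<phi> x) = \<phi> (the_inv_into (space M) T x)" if x: "x \<in> space M" for x
    proof (rule the_inv_into_f_eq)
      show "inj_on ?T (space ?E)" using b by (simp add: bij_betw_def)
      have "x \<in> T ` space M" using bij x by (simp add: bij_betw_def)
      then show "?T (\<phi> (the_inv_into (space M) T x)) = \<phi> x"
        using bij by (simp add: bij_betw_def f_the_inv_into_f)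
      show "\<phi> (the_inv_into (space M) T x) \<in> space ?E"
        using measurable_space[OF Ti x] by (simp add: space_embed_measure)
    qed
    then show "(\<lambda>x. the_inv_into (space ?E) ?T (\<phi> x)) \<in> measurable M ?E"
      using measurable_compose[OF Ti \<phi>m] by (simp cong: measurable_cong)
  qed
  moreover have "distr ?E ?E ?T = ?E"
  proof -
    have "distr ?E ?E ?T = distr (distr M ?E \<phi>) ?E ?T" using E by simp
    also have "\<dots> = distr M ?E (?T \<circ> \<phi>)" by (rule distr_distr[OF Tm' \<phi>m])
    also have "?T \<circ> \<phi> = \<phi> \<circ> T" by auto
    also have "distr M ?E (\<phi> \<circ> T) = distr (distr M M T) ?E \<phi>" by (rule distr_distr[OF \<phi>m Tm, symmetric])
    also have "\<dots> = ?E" using E D by simp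
    finally show ?thesis .
  qed
  ultimately show ?thesis by (simp add: measure_preserving_system_def)
qed

lemma embedded_orbit:
  assumes "inj \<phi>"
  shows "((\<lambda>x. \<phi> (T (inv \<phi> x))) ^^ n) (\<phi> x) = \<phi> ((T ^^ n) x)"
  using assms by (induction n) auto

lemma embedded_integrable:
  fixes f :: "'a \<Rightarrow> real"
  assumes \<phi>: "inj \<phi>" and f: "integrable M f"
  shows "integrable (embed_measure M \<phi>) (\<lambda>x. f (inv \<phi> x))"
proof (subst embed_measure_eq_distr[OF \<phi>], subst integrable_distr_eq)
  show "\<phi> \<in> measurable M (embed_measure M \<phi>)" by (rule measurable_embed_measure2[OF \<phi>])
  show "(\<lambda>x. f (inv \<phi> x)) \<in> borel_measurable (embed_measure M \<phi>)"
    by (rule measurable_embed_measure1) (use f \<phi> in simp)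
  show "integrable M (\<lambda>x. f (inv \<phi> (\<phi> x)))" using f \<phi> by simp
qed

text \<open>A sequence is determined by its graph, a subset of a countable set.\<close>

lemma ex_inj_sequences_to_real:
  "\<exists>\<phi> :: ('i::countable \<Rightarrow> 'b::countable) \<Rightarrow> real. inj \<phi>"
proof -
  obtain h :: "nat set \<Rightarrow> real" where h: "inj h"
    using nat_sets_eqpoll_reals unfolding eqpoll_def bij_betw_def by blast
  define G :: "('i \<Rightarrow> 'b) \<Rightarrow> nat set" where "G x = range (\<lambda>i. to_nat (i, x i))" for x
  have "inj G"
  proof (rule injI, rule ext)
    fix x y i assume "G x = G y"
    then have "to_nat (i, x i) \<in> G y" by (auto simp: G_def)
    then show "x i = y i" by (auto simp: G_def)
  qed
  then show ?thesis using h by (intro exI[of _ "h \<circ> G"]) (rule inj_compose)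
qed

lemma AE_iterate_preserving:
  assumes "T \<in> measurable M M" "distr M M T = M" "AE x in M. P x"
  shows "AE x in M. P ((T ^^ n) x)"
proof (induction n)
  case (Suc n)
  then have "AE x in distr M M T. P ((T ^^ n) x)" unfolding assms(2) .
  then have "AE x in M. P ((T ^^ n) (T x))" by (rule AE_distrD[OF assms(1)])
  then show ?case by (simp add: funpow_swap1)
qed (use assms in simp)

section \<open>Product systems and Bernoulli shifts\<close>

lemma measure_preserving_systemI_bij:
  assumes "prob_space M" "space M = UNIV" "bij T" "T \<in> measurable M M" "inv T \<in> measurable M M" "distr M M T = M"
  shows "measure_preserving_system M T"
proof -
  have "the_inv_into UNIV T = inv T"
  proof
    fix y
    show "the_inv_into UNIV T y = inv T y"
      using assms(3) by (intro the_inv_into_f_eq) (auto simp: bij_def surj_f_inv_f)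
  qed
  then show ?thesis using assms by (simp add: measure_preserving_system_def)
qed

lemma product_system:
  fixes p :: "'i \<Rightarrow> 'a pmf" and \<tau> :: "'i \<Rightarrow> 'a \<Rightarrow> 'a"
  assumes bij: "\<And>i. bij (\<tau> i)" and inv: "\<And>i. map_pmf (\<tau> i) (p i) = p i"
  shows "measure_preserving_system (PiM UNIV (\<lambda>i. measure_pmf (p i))) (\<lambda>x i. \<tau> i (x i))"
proof -
  let ?N = "\<lambda>i. measure_pmf (p i)"
  let ?M = "PiM UNIV ?N" and ?T = "\<lambda>x i. \<tau> i (x i)"
  interpret product_prob_space ?N UNIV
    by unfold_locales
  have meas: "(\<lambda>x i. \<theta> i (x i)) \<in> measurable ?M ?M" for \<theta> :: "'i \<Rightarrow> 'a \<Rightarrow> 'a"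
    by (rule measurable_abs_UNIV, rule measurable_compose[OF measurable_component_singleton]) auto
  have sp: "space ?M = UNIV" by (simp add: space_PiM)
  have inverse: "?T ((\<lambda>x i. inv (\<tau> i) (x i)) y) = y" "(\<lambda>x i. inv (\<tau> i) (x i)) (?T y) = y" for y
    using bij by (auto simp: bij_is_surj bij_is_inj surj_f_inv_f)
  have "bij ?T"
    by (rule bij_betw_byWitness[where f' = "\<lambda>x i. inv (\<tau> i) (x i)"]) (use inverse in auto)
  moreover have "inv ?T = (\<lambda>x i. inv (\<tau> i) (x i))"
    by (rule inv_unique_comp) (use inverse in \<open>auto simp: fun_eq_iff\<close>)
  moreover have "distr ?M ?M ?T = ?M"
  proof (rule PiM_eq)
    fix J F assume J: "finite J" "J \<subseteq> UNIV" "\<And>j. j \<in> J \<Longrightarrow> F j \<in> sets (?N j)"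
    have "?T -` prod_emb UNIV ?N J (Pi\<^sub>E J F) \<inter> space ?M = {x\<in>space ?M. \<forall>j\<in>J. x j \<in> \<tau> j -` F j}"
      by (auto simp: prod_emb_def sp space_PiM PiE_iff)
    then have "emeasure (distr ?M ?M ?T) (prod_emb UNIV ?N J (Pi\<^sub>E J F)) =
        emeasure ?M {x\<in>space ?M. \<forall>j\<in>J. x j \<in> \<tau> j -` F j}"
      using J by (subst emeasure_distr[OF meas]) (auto intro: sets_PiM_I)
    also have "\<dots> = (\<Prod>j\<in>J. emeasure (?N j) (\<tau> j -` F j))"
      using J by (intro emeasure_PiM_Collect) auto
    also have "\<dots> = (\<Prod>j\<in>J. emeasure (?N j) (F j))"
    proof (rule prod.cong[OF refl])
      fix j
      show "emeasure (?N j) (\<tau> j -` F j) = emeasure (?N j) (F j)"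
        by (metis emeasure_map_pmf inv)
    qed
    finally show "emeasure (distr ?M ?M ?T) (prod_emb UNIV ?N J (Pi\<^sub>E J F)) = (\<Prod>j\<in>J. emeasure (?N j) (F j))" .
  qed simp
  ultimately show ?thesis
    using meas[of \<tau>] meas[of "\<lambda>i. inv (\<tau> i)"] sp P.prob_space_axioms
    by (intro measure_preserving_systemI_bij) auto
qed

lemma bernoulli_shift_system:
  fixes q :: "'a pmf"
  shows "measure_preserving_system (PiM (UNIV :: int set) (\<lambda>_. measure_pmf q)) (\<lambda>y i. y (i + 1))"
proof -
  let ?N = "\<lambda>_::int. measure_pmf q"
  let ?M = "PiM UNIV ?N"
  interpret product_prob_space ?N UNIV
    by unfold_locales
  have meas: "(\<lambda>y i. y (i + c)) \<in> measurable ?M ?M" for c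
    by (rule measurable_abs_UNIV, rule measurable_component_singleton) auto
  have sp: "space ?M = UNIV" by (simp add: space_PiM)
  have "bij (\<lambda>(y :: int \<Rightarrow> 'a) i. y (i + 1))"
    by (rule bij_betw_byWitness[where f' = "\<lambda>y i. y (i + (-1))"]) auto
  moreover have "inv (\<lambda>(y :: int \<Rightarrow> 'a) i. y (i + 1)) = (\<lambda>y i. y (i + (-1)))"
    by (rule inv_unique_comp) (auto simp: fun_eq_iff)
  moreover have "distr ?M ?M (\<lambda>y i. y (i + 1)) = ?M"
    using distr_PiM_reindex[of UNIV ?N "\<lambda>i. i + 1" UNIV, OF prob_space_measure_pmf]
    by (simp add: inj_on_def restrict_def)
  ultimately show ?thesis
    using meas[of 1] meas[of "-1"] sp P.prob_space_axioms
    by (intro measure_preserving_systemI_bij) auto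
qed

lemma shift_orbit: "((\<lambda>(y :: int \<Rightarrow> 'a) i. y (i + 1)) ^^ n) y i = y (i + int n)"
  by (induction n arbitrary: i) (auto simp: algebra_simps)

section \<open>Unbounded counting ratio along almost every orbit\<close>

lemma iterate_rotation:
  fixes m :: nat
  assumes "x < m"
  shows "((\<lambda>x. if x < m then (x + 1) mod m else x) ^^ k) x = (x + k) mod m"
proof (induction k)
  case 0
  then show ?case using assms by simp
next
  case (Suc k)
  have "(x + k) mod m < m" using assms by simp
  with Suc show ?case by (simp add: mod_Suc_eq)
qed

lemma bij_rotation: "bij (\<lambda>x. if x < m then (x + 1) mod m else x :: nat)"
proof -
  define \<tau> where "\<tau> = (\<lambda>x. if x < m then (x + 1) mod m else x)"
  have "\<tau> ` {..<m} \<subseteq> {..<m}" by (auto simp: \<tau>_def)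
  moreover have "inj \<tau>"
  proof (rule injI)
    fix x y assume "\<tau> x = \<tau> y"
    then show "x = y"
      by (auto simp: \<tau>_def mod_Suc split: if_splits)
  qed
  ultimately have img: "\<tau> ` {..<m} = {..<m}"
    by (intro endo_inj_surj inj_on_subset[OF \<open>inj \<tau>\<close>]) auto
  have "y \<in> range \<tau>" for y
  proof (cases "y < m")
    case True
    then have "y \<in> \<tau> ` {..<m}" unfolding img by simp
    then show ?thesis by blast
  next
    case False
    then have "\<tau> y = y" by (simp add: \<tau>_def)
    then show ?thesis by (rule range_eqI[OF sym])
  qed
  then have "surj \<tau>" by blast
  with \<open>inj \<tau>\<close> show ?thesis by (simp add: bij_def \<tau>_def)
qed

lemma rotation_uniform:
  fixes m :: nat
  assumes "0 < m"
  shows "map_pmf (\<lambda>x. if x < m then (x + 1) mod m else x) (pmf_of_set {..<m}) = pmf_of_set {..<m}"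
proof -
  define \<tau> where "\<tau> = (\<lambda>x. if x < m then (x + 1) mod m else x)"
  have inj: "inj_on \<tau> {..<m}" 
    using bij_rotation[of m] unfolding \<tau>_def[symmetric] by (rule inj_on_subset[OF bij_is_inj subset_UNIV])
  have "\<tau> ` {..<m} \<subseteq> {..<m}" by (auto simp: \<tau>_def)
  then have "\<tau> ` {..<m} = {..<m}" using inj by (intro endo_inj_surj) auto
  then show ?thesis using map_pmf_of_set_inj[OF inj] assms by (simp add: \<tau>_def[symmetric] lessThan_empty_iff)
qed

text \<open>
  Coordinate \<open>i\<close> runs through a cycle with a function \<open>g i\<close> of mean at most \<open>2\<^sup>-\<^sup>i\<close> whose counting
  ratio reaches \<open>i\<close> outside a set of proportion at most \<open>2\<^sup>-\<^sup>i\<close>. The means are summable, so the sum \<open>f\<close> of the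
  \<open>g i (x i)\<close> is integrable. By Borel and Cantelli almost every \<open>x\<close> lies in only finitely many of the
  exceptional sets, and \<open>f \<ge> g i (x i)\<close> inherits the ratio \<open>i\<close> for all large \<open>i\<close>.
\<close>

lemma ex_counting_failure:
  obtains M :: "(nat \<Rightarrow> nat) measure" and T f where
    "measure_preserving_system M T" "integrable M f"
    "AE x in M. \<forall>L. \<exists>n\<ge>1. tail_count_ge (\<lambda>k. f ((T ^^ k) x)) n L"
proof -
  define bad where "bad m f L = {x. x < m \<and> (\<forall>n\<ge>1. \<not> tail_count_ge (\<lambda>k. f (x + k)) n L)}"
    for m :: nat and f :: "nat \<Rightarrow> real" and L
  define good where "good i m f \<longleftrightarrow> 0 < m \<and> (\<forall>x. f (x + m) = f x) \<and> (\<forall>x. 0 \<le> f x) \<and>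
      (\<Sum>x<m. f x) \<le> m / 2 ^ i \<and> real (card (bad m f i)) \<le> (1/2) ^ i * m"
    for i m :: nat and f :: "nat \<Rightarrow> real"
  have "\<exists>m f. good i m f" for i
  proof -
    obtain m :: nat and f :: "nat \<Rightarrow> real" where "0 < m" "\<And>x. f (x + m) = f x" "\<And>x. 0 \<le> f x"
      "(\<Sum>x<m. f x) \<le> m / real (2 ^ i)"
      "real (card {x. x < m \<and> (\<forall>n\<ge>1. \<not> tail_count_ge (\<lambda>k. f (x + k)) n i)}) \<le> (1/2) ^ i * m"
      by (rule cyclic_counting_blowup[of "(1/2) ^ i" "2 ^ i" "real i"]) auto
    then have "good i m f" unfolding good_def bad_def by simp
    then show ?thesis by blast
  qed
  then obtain m g where good: "\<And>i. good i (m i) (g i)" by metis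
  have m: "0 < m i" and per: "g i (x + m i) = g i x" and nonneg: "0 \<le> g i x"
    and gsum: "(\<Sum>x<m i. g i x) \<le> m i / 2 ^ i" and badcard: "real (card (bad (m i) (g i) i)) \<le> (1/2) ^ i * m i" for i x
    using good[of i] by (auto simp: good_def)
  have permod: "g i (x mod m i) = g i x" for i x
  proof -
    have "g i (x + k * m i) = g i x" for k x
      by (induction k) (use per in \<open>auto simp: add.assoc[symmetric] add.commute[of "m i"]\<close>)
    from this[of "x mod m i" "x div m i"] show ?thesis by simp
  qed

  \<comment> \<open>The rotation is extended by the identity beyond \<open>m i\<close>, on a null set, to be a bijection of
    the whole type.\<close>
  define p where "p i = pmf_of_set {..<m i}" for i
  define \<tau> where "\<tau> i = (\<lambda>x. if x < m i then (x + 1) mod m i else x)" for i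
  define M where "M = PiM UNIV (\<lambda>i. measure_pmf (p i))"
  define T :: "(nat \<Rightarrow> nat) \<Rightarrow> nat \<Rightarrow> nat" where "T = (\<lambda>x i. \<tau> i (x i))"
  define f where "f x = (\<Sum>i. g i (x i))" for x
  interpret P: product_prob_space "\<lambda>i. measure_pmf (p i)" UNIV by unfold_locales
  have setp: "set_pmf (p i) = {..<m i}" for i
    unfolding p_def using m[of i] by (intro set_pmf_of_set) (auto simp: lessThan_empty_iff)
  have MT: "measure_preserving_system M T"
    unfolding M_def T_def
    by (rule product_system) (use bij_rotation rotation_uniform m in \<open>auto simp: \<tau>_def p_def\<close>)
  have Tm: "T \<in> measurable M M" and TM: "distr M M T = M" using MT by (auto simp: measure_preserving_system_def)
  have orbit: "(T ^^ k) x i = (\<tau> i ^^ k) (x i)" for k x i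
    by (induction k) (auto simp: T_def)
  have comp: "(\<lambda>x. x i) \<in> measurable M (measure_pmf (p i))" for i
    unfolding M_def by (rule measurable_component_singleton) auto
  have distr_comp: "distr M (measure_pmf (p i)) (\<lambda>x. x i) = measure_pmf (p i)" for i
    unfolding M_def by (rule P.PiM_component) auto

  have int_comp: "integrable M (\<lambda>x. g i (x i))" for i
    using comp[of i]
    by (subst integrable_distr_eq[of "\<lambda>x. x i" M "measure_pmf (p i)", symmetric])
       (auto simp: distr_comp setp intro: integrable_measure_pmf_finite)
  have expect_comp: "(\<integral>x. g i (x i) \<partial>M) \<le> (1/2) ^ i" for i
  proof -
    have "(\<integral>x. g i (x i) \<partial>M) = (\<integral>x. g i x \<partial>distr M (measure_pmf (p i)) (\<lambda>x. x i))"
      by (rule integral_distr[symmetric]) (use comp in auto)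
    also have "\<dots> = (\<Sum>x<m i. g i x) / m i"
      unfolding distr_comp unfolding p_def using m[of i] by (subst integral_pmf_of_set) (auto simp: lessThan_empty_iff)
    also have "\<dots> \<le> (1/2) ^ i"
      using gsum[of i] m[of i] by (simp add: field_simps power_one_over)
    finally show ?thesis .
  qed
  have sum_expect: "summable (\<lambda>i. \<integral>x. g i (x i) \<partial>M)"
    by (rule summable_comparison_test'[where g = "\<lambda>i. (1/2) ^ i" and N = 0])
       (use expect_comp nonneg in \<open>auto intro: summable_geometric simp: integral_nonneg_AE\<close>)

  have AE_sum: "AE x in M. summable (\<lambda>i. g i (x i))"
  proof -
    have meas: "(\<lambda>x. ennreal (g i (x i))) \<in> borel_measurable M" for i
      using int_comp[of i] by simp
    have "(\<integral>\<^sup>+x. (\<Sum>i. ennreal (g i (x i))) \<partial>M) = (\<Sum>i. \<integral>\<^sup>+x. ennreal (g i (x i)) \<partial>M)"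
      by (rule nn_integral_suminf) (rule meas)
    also have "\<dots> = (\<Sum>i. ennreal (\<integral>x. g i (x i) \<partial>M))"
      by (intro suminf_cong nn_integral_eq_integral int_comp) (use nonneg in auto)
    also have "\<dots> = ennreal (\<Sum>i. \<integral>x. g i (x i) \<partial>M)"
      by (intro suminf_ennreal2 sum_expect) (use nonneg in \<open>auto intro: integral_nonneg_AE\<close>)
    finally have "(\<integral>\<^sup>+x. (\<Sum>i. ennreal (g i (x i))) \<partial>M) \<noteq> \<infinity>" by simp
    then have "AE x in M. (\<Sum>i. ennreal (g i (x i))) \<noteq> \<infinity>"
      using meas by (intro nn_integral_PInf_AE) auto
    then show ?thesis
    proof eventually_elim
      case (elim x)
      then show ?case using nonneg by (intro summable_suminf_not_top) auto
    qed
  qed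
  have int_f: "integrable M f"
    unfolding f_def
    by (rule integrable_suminf[OF int_comp]) (use AE_sum sum_expect nonneg in auto)

  \<comment> \<open>A divergent \<^const>\<open>suminf\<close> has no useful value, so the comparison of \<open>f\<close> with \<open>g i\<close>
    needs convergence at every point of the orbit.\<close>
  have AE_orbit_sum: "AE x in M. \<forall>k. summable (\<lambda>i. g i ((T ^^ k) x i))"
    unfolding AE_all_countable using AE_iterate_preserving[OF Tm TM AE_sum] by blast
  have AE_range: "AE x in M. \<forall>i. x i < m i"
    unfolding AE_all_countable M_def
  proof
    fix i show "AE x in PiM UNIV (\<lambda>i. measure_pmf (p i)). x i < m i"
      by (rule P.AE_component) (use setp in \<open>auto simp: AE_measure_pmf_iff\<close>)
  qed

  define A where "A i = {x \<in> space M. x i \<in> bad (m i) (g i) i}" for i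
  have A_sets: "A i \<in> sets M" for i
    using measurable_sets[OF comp[of i], of "bad (m i) (g i) i"] by (simp add: A_def vimage_def Int_def conj_commute)
  have A_meas: "measure M (A i) \<le> (1/2) ^ i" for i
  proof -
    have "measure M (A i) = measure (distr M (measure_pmf (p i)) (\<lambda>x. x i)) (bad (m i) (g i) i)"
      by (subst measure_distr[OF comp]) (auto simp: A_def intro: arg_cong[where f = "measure M"])
    also have "\<dots> = card ({..<m i} \<inter> bad (m i) (g i) i) / m i"
      unfolding distr_comp unfolding p_def using m[of i] by (subst measure_pmf_of_set) (auto simp: lessThan_empty_iff)
    also have "{..<m i} \<inter> bad (m i) (g i) i = bad (m i) (g i) i" by (auto simp: bad_def)
    also have "card (bad (m i) (g i) i) / real (m i) \<le> (1/2) ^ i"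
      using badcard[of i] m[of i] by (simp add: pos_divide_le_eq)
    finally show ?thesis .
  qed
  have "AE x in M. eventually (\<lambda>i. x \<in> space M - A i) sequentially"
  proof (rule borel_cantelli_AE1[OF A_sets])
    show "emeasure M (A i) < \<infinity>" for i
      using P.emeasure_finite[of "A i"] by (simp add: M_def less_top[symmetric])
    show "summable (\<lambda>i. measure M (A i))"
      by (rule summable_comparison_test'[where g = "\<lambda>i. (1/2) ^ i" and N = 0])
         (use A_meas in \<open>auto intro: summable_geometric\<close>)
  qed
  with AE_range AE_orbit_sum
  have "AE x in M. \<forall>L. \<exists>n\<ge>1. tail_count_ge (\<lambda>k. f ((T ^^ k) x)) n L"
  proof eventually_elim
    case (elim x)
    show ?case
    proof
      fix L :: real
      obtain I where I: "\<And>i. I \<le> i \<Longrightarrow> x \<in> space M - A i"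
        using elim(3) unfolding eventually_sequentially by blast
      obtain J :: nat where "L \<le> J" using real_arch_simple by blast
      define i where "i = max I J"
      have "x i \<notin> bad (m i) (g i) i" using I[of i] by (simp add: i_def A_def)
      then obtain n where n: "1 \<le> n" "tail_count_ge (\<lambda>k. g i (x i + k)) n i"
        using elim(1) unfolding bad_def by blast
      have ge: "g i (x i + k) \<le> f ((T ^^ k) x)" for k
      proof -
        have "(T ^^ k) x i = (x i + k) mod m i"
          unfolding orbit \<tau>_def by (rule iterate_rotation) (use elim(1) in blast)
        then have "g i (x i + k) = g i ((T ^^ k) x i)" using permod by simp
        also have "\<dots> = (\<Sum>j\<in>{i}. g j ((T ^^ k) x j))" by simp
        also have "\<dots> \<le> f ((T ^^ k) x)"
          unfolding f_def by (rule sum_le_suminf) (use elim(2) nonneg in auto)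
        finally show ?thesis .
      qed
      have "L \<le> real i" using \<open>L \<le> J\<close> by (simp add: i_def)
      then have "tail_count_ge (\<lambda>k. f ((T ^^ k) x)) n L"
        by (rule tail_count_ge_mono[OF n(2) _ ge])
      then show "\<exists>n\<ge>1. tail_count_ge (\<lambda>k. f ((T ^^ k) x)) n L" using n(1) by blast
    qed
  qed
  then show ?thesis using that MT int_f by blast
qed

section \<open>A Bernoulli shift detecting the failure\<close>

text \<open>
  A geometric variable picks \<open>j\<close> with probability \<open>2\<^sup>-\<^sup>j\<^sup>-\<^sup>1\<close>; then the value is \<open>h j\<close> with probability
  \<open>1 / h j\<close> and \<open>0\<close> otherwise. Every layer has conditional mean \<open>1\<close>, hence so has the mixture, however
  fast \<open>h\<close> grows.
\<close>

lemma ex_layered_pmf: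
  fixes h :: "nat \<Rightarrow> nat"
  assumes h: "\<And>j. 1 \<le> h j"
  obtains q :: "nat pmf" where "integrable (measure_pmf q) real"
    "\<And>j. (1/2) ^ (j+1) / h j \<le> measure (measure_pmf q) {h j..}"
proof -
  define G where "G = geometric_pmf (1/2)"
  define K where "K j = map_pmf (\<lambda>b. if b then h j else 0) (bernoulli_pmf (1 / real (h j)))" for j
  define q where "q = bind_pmf G K"
  have h01: "0 \<le> 1 / real (h j)" "1 / real (h j) \<le> 1" "0 < real (h j)" for j
    using h[of j] by auto
  have "(\<integral>\<^sup>+x. ennreal (real x) \<partial>measure_pmf (K j)) = 1" for j
    using h01[of j] h[of j]
    by (simp add: K_def nn_integral_bernoulli_pmf ennreal_mult[symmetric] ennreal_1[symmetric] del: ennreal_1)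
  then have "(\<integral>\<^sup>+x. ennreal (real x) \<partial>measure_pmf q) = 1"
    by (simp add: q_def nn_integral_bind_pmf measure_pmf.emeasure_space_1)
  then have "integrable (measure_pmf q) real"
    by (intro integrableI_bounded) (auto simp: ennreal_1[symmetric] simp del: ennreal_1)
  moreover have "(1/2) ^ (j+1) / h j \<le> measure (measure_pmf q) {h j..}" for j
  proof -
    have "ennreal ((1/2) ^ (j+1) / h j) = ennreal (1 / real (h j)) * ennreal ((1/2) ^ (j+1))"
      by (subst ennreal_mult[symmetric]) (auto simp: mult.commute)
    also have "\<dots> = ennreal (1 / real (h j)) * emeasure (measure_pmf G) {j}"
      by (simp add: G_def emeasure_pmf_single power_one_over mult.commute)
    also have "ennreal (1 / real (h j)) \<le> emeasure (measure_pmf (K j)) {h j..}"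
    proof -
      have "ennreal (1 / real (h j)) = emeasure (measure_pmf (bernoulli_pmf (1 / real (h j)))) {True}"
        using h01[of j] by (simp add: emeasure_pmf_single)
      also have "\<dots> \<le> emeasure (measure_pmf (bernoulli_pmf (1 / real (h j)))) ((\<lambda>b. if b then h j else 0) -` {h j..})"
        by (rule emeasure_mono) auto
      finally show ?thesis by (simp add: K_def)
    qed
    also have "emeasure (measure_pmf (K j)) {h j..} * emeasure (measure_pmf G) {j} = (\<integral>\<^sup>+i. emeasure (measure_pmf (K i)) {h j..} * indicator {j} i \<partial>measure_pmf G)"
    proof -
      have "(\<integral>\<^sup>+i. emeasure (measure_pmf (K i)) {h j..} * indicator {j} i \<partial>measure_pmf G) = (\<integral>\<^sup>+i. emeasure (measure_pmf (K j)) {h j..} * indicator {j} i \<partial>measure_pmf G)"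
        by (rule nn_integral_cong) (auto simp: indicator_def)
      then show ?thesis by (simp add: nn_integral_cmult)
    qed
    also have "\<dots> \<le> (\<integral>\<^sup>+i. emeasure (measure_pmf (K i)) {h j..} \<partial>measure_pmf G)"
      by (rule nn_integral_mono) (auto simp: indicator_def)
    also have "\<dots> = emeasure (measure_pmf q) {h j..}"
      by (simp add: q_def emeasure_bind_pmf)
    finally show ?thesis
      by (simp add: measure_pmf.emeasure_eq_measure mult_right_mono)
  qed
  ultimately show ?thesis using that by blast
qed

text \<open>
  If the counting ratio is unbounded, it remains unbounded when the times up to \<open>K\<close> are discarded,
  since they account for at most \<open>K\<close> in the count.
\<close>

lemma tail_count_ge_late:
  assumes "\<forall>L. \<exists>n\<ge>1. tail_count_ge u n L"
  shows "\<exists>n D. 1 \<le> n \<and> finite D \<and> D \<subseteq> {k. K < k \<and> real k \<le> real n * u k} \<and> L * real n \<le> real (card D)"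
proof -
  obtain n D where n: "1 \<le> n" and D: "finite D" "D \<subseteq> {k. 1 \<le> k \<and> real k \<le> real n * u k}"
    "(L + K) * real n \<le> real (card D)"
    using assms[rule_format, of "L + K"] unfolding tail_count_ge_def by blast
  have "card D - card {1..K} \<le> card (D - {1..K})" by (rule diff_card_le_card_Diff) simp
  then have "real (card D) \<le> real (card (D - {1..K})) + real K" by simp
  moreover have "real K * 1 \<le> real K * real n" using n by (intro mult_left_mono) auto
  ultimately have "L * real n \<le> real (card (D - {1..K}))"
    using D(3) by (simp add: algebra_simps)
  then show ?thesis using n D(1,2)
    by (intro exI[of _ n] exI[of _ "D - {1..K}"]) (auto simp: not_le)
qed

text \<open>
  The system depends on \<open>u\<close>. Independence makes the probability of missing all times in \<open>D j\<close> a
  product over \<open>D j\<close>, and the size of \<open>D j\<close> makes this product summable in \<open>j\<close>. Taking the times in \<open>D j\<close>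
  larger than \<open>j\<close> ensures that the values of \<open>n\<close> at which the quotient is at least \<open>1\<close> are unbounded.
\<close>

lemma ex_system_detecting_visits:
  fixes u :: "nat \<Rightarrow> real"
  assumes u: "\<forall>L. \<exists>n\<ge>1. tail_count_ge u n L"
  obtains N :: "(int \<Rightarrow> nat) measure" and S g where
    "measure_preserving_system N S" "integrable N g"
    "AE y in N. \<not> (\<lambda>n. u n * g ((S ^^ n) y) / real n) \<longlonglongrightarrow> 0"
proof -
  define Q where "Q j n D \<longleftrightarrow> 1 \<le> n \<and> finite D \<and> D \<subseteq> {k. j < k \<and> real k \<le> real n * u k} \<and>
      real (j * 2 ^ (j+1)) * real n \<le> real (card D)" for j n D
  have "\<exists>n D. Q j n D" for j
    unfolding Q_def by (rule tail_count_ge_late[OF u])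
  then obtain h D where "\<And>j. Q j (h j) (D j)" by metis
  then have h: "1 \<le> h j" and finD: "finite (D j)"
    and D: "D j \<subseteq> {k. j < k \<and> real k \<le> real (h j) * u k}"
    and cardD: "real (j * 2 ^ (j+1)) * real (h j) \<le> real (card (D j))" for j
    unfolding Q_def by blast+
  obtain q :: "nat pmf" where q: "integrable (measure_pmf q) real"
    "\<And>j. (1/2) ^ (j+1) / h j \<le> measure (measure_pmf q) {h j..}"
    by (rule ex_layered_pmf[of h, OF h]) blast

  define N where "N = PiM (UNIV :: int set) (\<lambda>_. measure_pmf q)"
  define S where "S = (\<lambda>(y :: int \<Rightarrow> nat) i. y (i + 1))"
  define g where "g y = real (y (0 :: int))" for y :: "int \<Rightarrow> nat"
  interpret P: product_prob_space "\<lambda>_ :: int. measure_pmf q" UNIV by unfold_locales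
  have NS: "measure_preserving_system N S"
    unfolding N_def S_def by (rule bernoulli_shift_system)
  have gS: "g ((S ^^ n) y) = real (y (int n))" for n y
    by (simp add: g_def S_def shift_orbit)
  have comp: "(\<lambda>y. y 0) \<in> measurable N (measure_pmf q)"
    unfolding N_def by (rule measurable_component_singleton) auto
  have "integrable (distr N (measure_pmf q) (\<lambda>y. y 0)) real"
    unfolding N_def using q(1) by (subst P.PiM_component) auto
  then have int_g: "integrable N g"
    unfolding g_def by (subst (asm) integrable_distr_eq) (use comp in auto)

  define miss where "miss j = {y \<in> space N. \<forall>i\<in>int ` D j. y i \<in> {..<h j}}" for j
  have miss_sets: "miss j \<in> sets N" for j
    unfolding miss_def
  proof (rule sets.sets_Collect_finite_All)
    fix i
    show "{y \<in> space N. y i \<in> {..<h j}} \<in> sets N"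
      unfolding N_def by (rule measurable_sets_Collect[OF measurable_component_singleton]) auto
  qed (use finD in simp)
  have miss_meas: "measure N (miss j) \<le> exp (-1) ^ j" for j
  proof -
    define \<pi> where "\<pi> = measure (measure_pmf q) {h j..}"
    have "emeasure N (miss j) = (\<Prod>i\<in>int ` D j. emeasure (measure_pmf q) {..<h j})"
      unfolding miss_def N_def by (rule P.emeasure_PiM_Collect) (use finD in auto)
    also have "\<dots> = ennreal (measure (measure_pmf q) {..<h j} ^ card (D j))"
      by (simp add: card_image measure_pmf.emeasure_eq_measure ennreal_power)
    finally have "measure N (miss j) = measure (measure_pmf q) {..<h j} ^ card (D j)"
      by (simp add: measure_def)
    also have "measure (measure_pmf q) {..<h j} = 1 - \<pi>"
      using measure_pmf.prob_compl[of "{h j..}" q] by (simp add: \<pi>_def Compl_atLeast Compl_eq_Diff_UNIV[symmetric])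
    also have "(1 - \<pi>) ^ card (D j) \<le> exp (- \<pi>) ^ card (D j)"
      using exp_ge_add_one_self[of "- \<pi>"] by (intro power_mono) (auto simp: \<pi>_def)
    also have "\<dots> = exp (- (\<pi> * card (D j)))"
      by (subst exp_of_nat_mult[symmetric]) (simp add: mult.commute)
    also have "\<dots> \<le> exp (- real j)"
    proof -
      have hj: "0 < real (h j)" using h[of j] by simp
      have "real j = ((1/2) ^ (j+1) / h j) * (real (j * 2 ^ (j+1)) * real (h j))"
        using hj by (simp add: field_simps)
      also have "\<dots> \<le> \<pi> * card (D j)"
        using q(2)[of j] cardD[of j] by (intro mult_mono) (auto simp: \<pi>_def)
      finally show ?thesis by simp
    qed
    also have "\<dots> = exp (-1) ^ j"
      by (subst exp_of_nat_mult[symmetric]) simp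
    finally show ?thesis .
  qed
  have "AE y in N. eventually (\<lambda>j. y \<in> space N - miss j) sequentially"
  proof (rule borel_cantelli_AE1[OF miss_sets])
    show "emeasure N (miss j) < \<infinity>" for j
      using P.emeasure_finite[of "miss j"] by (simp add: N_def less_top[symmetric])
    show "summable (\<lambda>j. measure N (miss j))"
      by (rule summable_comparison_test'[where g = "\<lambda>j. exp (-1) ^ j" and N = 0])
         (use miss_meas in \<open>auto intro: summable_geometric\<close>)
  qed
  then have "AE y in N. \<not> (\<lambda>n. u n * g ((S ^^ n) y) / real n) \<longlonglongrightarrow> 0"
  proof eventually_elim
    case (elim y)
    then obtain J where J: "\<And>j. J \<le> j \<Longrightarrow> y \<in> space N - miss j"
      unfolding eventually_sequentially by blast
    show ?case
    proof
      assume "(\<lambda>n. u n * g ((S ^^ n) y) / real n) \<longlonglongrightarrow> 0"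
      then have "eventually (\<lambda>n. u n * g ((S ^^ n) y) / real n < 1) sequentially"
        by (rule order_tendstoD) simp
      then obtain n0 where n0: "\<And>n. n0 \<le> n \<Longrightarrow> u n * real (y (int n)) / real n < 1"
        unfolding eventually_sequentially gS by blast
      define j where "j = max J n0"
      have "y \<in> space N - miss j" by (rule J) (simp add: j_def)
      then obtain k where k: "k \<in> D j" "h j \<le> y (int k)"
        by (auto simp: miss_def not_less)
      have k': "j < k" "real k \<le> real (h j) * u k" using D k(1) by auto
      have "0 < real (h j) * u k" using k' by linarith
      then have "0 < u k" using h[of j] by (simp add: zero_less_mult_iff)
      then have "real (h j) * u k \<le> real (y (int k)) * u k"
        using k(2) by (intro mult_right_mono) auto
      then have "real k \<le> u k * real (y (int k))" using k'(2) by (simp add: mult.commute)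
      then have "1 \<le> u k * real (y (int k)) / real k" using k'(1) by (simp add: pos_le_divide_eq)
      moreover have "n0 \<le> k" using k'(1) by (simp add: j_def)
      ultimately show False using n0[of k] by simp
    qed
  qed
  then show ?thesis using that NS int_g by blast
qed

section \<open>Failure of the return times property for the tail\<close>

theorem theorem2:
  shows "\<exists>(M :: real measure) (T :: real \<Rightarrow> real) (f :: real \<Rightarrow> real).
    measure_preserving_system M T \<and> integrable M f \<and>
    \<not> (\<exists>Xf \<in> sets M. measure M Xf = 1 \<and>
         (\<forall>x \<in> Xf. \<forall>(N :: real measure) (S :: real \<Rightarrow> real) (g :: real \<Rightarrow> real).
            measure_preserving_system N S \<longrightarrow> integrable N g \<longrightarrow>
            (AE y in N. (\<lambda>n :: nat. f ((T ^^ n) x) * g ((S ^^ n) y) / real n) \<longlonglongrightarrow> 0)))"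
proof -
  obtain M0 :: "(nat \<Rightarrow> nat) measure" and T0 f0 where M0: "measure_preserving_system M0 T0"
    and f0: "integrable M0 f0"
    and blowup: "AE x in M0. \<forall>L. \<exists>n\<ge>1. tail_count_ge (\<lambda>k. f0 ((T0 ^^ k) x)) n L"
    by (rule ex_counting_failure)
  obtain \<phi> :: "(nat \<Rightarrow> nat) \<Rightarrow> real" where \<phi>: "inj \<phi>" using ex_inj_sequences_to_real by blast
  obtain \<psi> :: "(int \<Rightarrow> nat) \<Rightarrow> real" where \<psi>: "inj \<psi>" using ex_inj_sequences_to_real by blast
  define M where "M = embed_measure M0 \<phi>"
  define T where "T = (\<lambda>x. \<phi> (T0 (inv \<phi> x)))"
  define f where "f = (\<lambda>x. f0 (inv \<phi> x))"
  have sys: "measure_preserving_system M T"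
    unfolding M_def T_def by (rule embedded_system[OF \<phi> M0])
  have "integrable M f"
    unfolding M_def f_def by (rule embedded_integrable[OF \<phi> f0])
  have orbit: "f ((T ^^ n) (\<phi> x)) = f0 ((T0 ^^ n) x)" for n x
    unfolding f_def T_def embedded_orbit[OF \<phi>] using \<phi> by simp
  have "\<not> (\<exists>Xf \<in> sets M. measure M Xf = 1 \<and>
         (\<forall>x \<in> Xf. \<forall>(N :: real measure) (S :: real \<Rightarrow> real) (g :: real \<Rightarrow> real).
            measure_preserving_system N S \<longrightarrow> integrable N g \<longrightarrow>
            (AE y in N. (\<lambda>n :: nat. f ((T ^^ n) x) * g ((S ^^ n) y) / real n) \<longlonglongrightarrow> 0)))"
  proof
    assume "\<exists>Xf \<in> sets M. measure M Xf = 1 \<and>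
         (\<forall>x \<in> Xf. \<forall>(N :: real measure) (S :: real \<Rightarrow> real) (g :: real \<Rightarrow> real).
            measure_preserving_system N S \<longrightarrow> integrable N g \<longrightarrow>
            (AE y in N. (\<lambda>n :: nat. f ((T ^^ n) x) * g ((S ^^ n) y) / real n) \<longlonglongrightarrow> 0))"
    then obtain Xf where Xf: "Xf \<in> sets M" "measure M Xf = 1"
      and tail: "\<And>x (N :: real measure) S g. x \<in> Xf \<Longrightarrow> measure_preserving_system N S \<Longrightarrow> integrable N g \<Longrightarrow>
            (AE y in N. (\<lambda>n :: nat. f ((T ^^ n) x) * g ((S ^^ n) y) / real n) \<longlonglongrightarrow> 0)"
      by blast
    interpret M: prob_space M using sys by (simp add: measure_preserving_system_def)
    interpret M0: prob_space M0 using M0 by (simp add: measure_preserving_system_def)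
    have "AE x in M. x \<in> Xf" using Xf(2) by (rule M.AE_prob_1)
    then have "AE x in M0. \<phi> x \<in> Xf" unfolding M_def by (simp add: AE_embed_measure[OF \<phi>])
    then have "AE x in M0. \<phi> x \<in> Xf \<and> (\<forall>L. \<exists>n\<ge>1. tail_count_ge (\<lambda>k. f0 ((T0 ^^ k) x)) n L)"
      using blowup by eventually_elim blast
    \<comment> \<open>A set of full measure contains a point with unbounded counting ratio, and for this point
      a second system can be chosen.\<close>
    then obtain x where x: "\<phi> x \<in> Xf" "\<forall>L. \<exists>n\<ge>1. tail_count_ge (\<lambda>k. f0 ((T0 ^^ k) x)) n L"
      using eventually_happens'[OF M0.ae_filter_bot] by blast
    obtain N0 :: "(int \<Rightarrow> nat) measure" and S0 g0 where N0: "measure_preserving_system N0 S0"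
      and g0: "integrable N0 g0"
      and diverges: "AE y in N0. \<not> (\<lambda>n. f0 ((T0 ^^ n) x) * g0 ((S0 ^^ n) y) / real n) \<longlonglongrightarrow> 0"
      by (rule ex_system_detecting_visits[OF x(2)])
    interpret N0: prob_space N0 using N0 by (simp add: measure_preserving_system_def)
    have "AE y in embed_measure N0 \<psi>.
        (\<lambda>n. f ((T ^^ n) (\<phi> x)) * g0 (inv \<psi> (((\<lambda>y. \<psi> (S0 (inv \<psi> y))) ^^ n) y)) / real n) \<longlonglongrightarrow> 0"
      by (rule tail[OF x(1) embedded_system[OF \<psi> N0] embedded_integrable[OF \<psi> g0]])
    then have "AE y in N0. (\<lambda>n. f0 ((T0 ^^ n) x) * g0 ((S0 ^^ n) y) / real n) \<longlonglongrightarrow> 0"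
      unfolding AE_embed_measure[OF \<psi>] embedded_orbit[OF \<psi>] orbit using \<psi> by simp
    with diverges have "AE y in N0. False" by eventually_elim blast
    then show False by simp
  qed
  with sys \<open>integrable M f\<close> show ?thesis by blast
qed

end
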